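(* Let $M$ be a Banach space. Then $M$ is isomorphic to a total nonnorming subspace of the dual $X^{*}$ of some Banach space $X$ if and only if $M^{*}$ contains a closed norming subspace of infinite codimension.
   Context: "Subspace" means closed linear subspace; isomorphic means linearly homeomorphic. For a Banach space $X$ with dual $X^{*}$, a subspace $N\subset X^{*}$ is total if for every $0\neq x\in X$ there is $f\in N$ with $f(x)\neq 0$; it is norming if there is $c>0$ such that $\sup_{f\in S(N)}|f(x)|\ge c\|x\|$ for all $x\in X$, where $S(N)$ is the unit sphere of $N$; it is nonnorming if it is not norming. A norming subspace of $M^{*}$ is understood in the same sense, with $M$ in the role of $X$. *)

theory Defs
  imports "HOL-Analysis.Analysis" "HOL-Library.Function_Algebras"
begin

text \<open>
  The space \<open>M\<close> is a type of class \<open>banach\<close> (real scalars), with dual \<open>'a \<Rightarrow>\<^sub>L real\<close>.  The space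
  \<open>X\<close> has to be quantified existentially, so it cannot be a type.  It is a pair \<open>(V, \<nu>)\<close> instead:
  a linear subspace \<open>V\<close> of some real vector space type and a complete norm \<open>\<nu>\<close> on \<open>V\<close> that is
  unrelated to any norm the ambient type may have.  Nothing is assumed about \<open>\<nu>\<close> outside \<open>V\<close>.
\<close>

instantiation "fun" :: (type, real_vector) real_vector
begin

definition scaleR_fun :: "real \<Rightarrow> ('a \<Rightarrow> 'b) \<Rightarrow> 'a \<Rightarrow> 'b" where
  "scaleR_fun r f = (\<lambda>x. r *\<^sub>R f x)"

instance
  by standard (auto simp: scaleR_fun_def plus_fun_def scaleR_add_right scaleR_add_left)

end

definition normed_space_on :: "'x::real_vector set \<Rightarrow> ('x \<Rightarrow> real) \<Rightarrow> bool" where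
  "normed_space_on V \<nu> \<longleftrightarrow> subspace V
     \<and> (\<forall>x\<in>V. 0 \<le> \<nu> x \<and> (\<nu> x = 0 \<longleftrightarrow> x = 0))
     \<and> (\<forall>r. \<forall>x\<in>V. \<nu> (r *\<^sub>R x) = \<bar>r\<bar> * \<nu> x)
     \<and> (\<forall>x\<in>V. \<forall>y\<in>V. \<nu> (x + y) \<le> \<nu> x + \<nu> y)"

definition banach_space_on :: "'x::real_vector set \<Rightarrow> ('x \<Rightarrow> real) \<Rightarrow> bool" where
  "banach_space_on V \<nu> \<longleftrightarrow> normed_space_on V \<nu>
     \<and> (\<forall>s::nat \<Rightarrow> 'x. (\<forall>k. s k \<in> V) \<longrightarrow> (\<forall>e>0. \<exists>N. \<forall>i\<ge>N. \<forall>j\<ge>N. \<nu> (s i - s j) < e)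
          \<longrightarrow> (\<exists>x\<in>V. (\<lambda>k. \<nu> (s k - x)) \<longlonglongrightarrow> 0))"

definition norm_topology :: "'x::real_vector set \<Rightarrow> ('x \<Rightarrow> real) \<Rightarrow> 'x topology" where
  "norm_topology V \<nu> =
     topology (\<lambda>U. U \<subseteq> V \<and> (\<forall>x\<in>U. \<exists>r>0. \<forall>y\<in>V. \<nu> (y - x) < r \<longrightarrow> y \<in> U))"

text \<open>
  A functional on \<open>V\<close> is represented by its extension by \<open>0\<close> outside \<open>V\<close>.  This representation is
  unique, and compatible with the pointwise vector space operations.
\<close>

definition dual_space :: "'x::real_vector set \<Rightarrow> ('x \<Rightarrow> real) \<Rightarrow> ('x \<Rightarrow> real) set" where
  "dual_space V \<nu> = {f. (\<forall>x\<in>V. \<forall>y\<in>V. f (x + y) = f x + f y)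
     \<and> (\<forall>r. \<forall>x\<in>V. f (r *\<^sub>R x) = r * f x)
     \<and> (\<exists>K. \<forall>x\<in>V. \<bar>f x\<bar> \<le> K * \<nu> x)
     \<and> (\<forall>x. x \<notin> V \<longrightarrow> f x = 0)}"

definition dual_norm :: "'x::real_vector set \<Rightarrow> ('x \<Rightarrow> real) \<Rightarrow> ('x \<Rightarrow> real) \<Rightarrow> real" where
  "dual_norm V \<nu> f = (SUP x\<in>{x\<in>V. \<nu> x \<le> 1}. \<bar>f x\<bar>)"

definition closed_dual_subspace ::
    "'x::real_vector set \<Rightarrow> ('x \<Rightarrow> real) \<Rightarrow> ('x \<Rightarrow> real) set \<Rightarrow> bool" where
  "closed_dual_subspace V \<nu> L \<longleftrightarrow> subspace L
     \<and> closedin (norm_topology (dual_space V \<nu>) (dual_norm V \<nu>)) L"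

definition linear_homeomorphism_onto ::
    "('a::real_normed_vector \<Rightarrow> 'y::real_vector) \<Rightarrow> 'y set \<Rightarrow> ('y \<Rightarrow> real) \<Rightarrow> bool" where
  "linear_homeomorphism_onto T L \<mu> \<longleftrightarrow>
     linear T \<and> homeomorphic_map euclidean (norm_topology L \<mu>) T"

definition total_on :: "'x::real_vector set \<Rightarrow> ('x \<Rightarrow> real) set \<Rightarrow> bool" where
  "total_on V L \<longleftrightarrow> (\<forall>x\<in>V. x \<noteq> 0 \<longrightarrow> (\<exists>f\<in>L. f x \<noteq> 0))"

text \<open>
  In the next definition \<open>S\<close> is the unit sphere of the subspace in question.  The supremum is taken
  in \<open>[0, \<infinity>]\<close>, so that it is \<open>0\<close> when the subspace is zero and its sphere is empty; the zero
  subspace of the dual of the zero space is thus norming.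
\<close>

definition norming_sphere :: "'x set \<Rightarrow> ('x \<Rightarrow> real) \<Rightarrow> ('x \<Rightarrow> real) set \<Rightarrow> bool" where
  "norming_sphere V \<nu> S \<longleftrightarrow> (\<exists>c>0. \<forall>x\<in>V. (SUP f\<in>S. ennreal \<bar>f x\<bar>) \<ge> ennreal (c * \<nu> x))"

definition norming_on :: "'x::real_vector set \<Rightarrow> ('x \<Rightarrow> real) \<Rightarrow> ('x \<Rightarrow> real) set \<Rightarrow> bool" where
  "norming_on V \<nu> L \<longleftrightarrow> norming_sphere V \<nu> {f\<in>L. dual_norm V \<nu> f = 1}"

definition norming :: "('a::real_normed_vector \<Rightarrow>\<^sub>L real) set \<Rightarrow> bool" where
  "norming W \<longleftrightarrow> norming_sphere UNIV norm (blinfun_apply ` {g\<in>W. norm g = 1})"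

text \<open>
  The quotient by \<open>W\<close> is finite-dimensional iff it is spanned by the classes of the elements of some
  finite set \<open>F\<close>, that is, iff \<open>W \<union> F\<close> spans the whole space.
\<close>

definition infinite_codimension :: "'y::real_vector set \<Rightarrow> bool" where
  "infinite_codimension W \<longleftrightarrow> \<not> (\<exists>F. finite F \<and> span (W \<union> F) = UNIV)"

definition isomorphic_to_total_nonnorming ::
    "'a::real_normed_vector itself \<Rightarrow> 'x::real_vector set \<Rightarrow> ('x \<Rightarrow> real) \<Rightarrow> bool" where
  "isomorphic_to_total_nonnorming M V \<nu> \<longleftrightarrow>
     (\<exists>L. closed_dual_subspace V \<nu> L \<and> total_on V L \<and> \<not> norming_on V \<nu> L
        \<and> (\<exists>T :: 'a \<Rightarrow> 'x \<Rightarrow> real. linear_homeomorphism_onto T L (dual_norm V \<nu>)))"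

text \<open>For types of class \<open>banach\<close> these notions are the library ones.\<close>

lemma openin_norm_topology:
  "openin (norm_topology V \<nu>) U \<longleftrightarrow>
     U \<subseteq> V \<and> (\<forall>x\<in>U. \<exists>r>0. \<forall>y\<in>V. \<nu> (y - x) < r \<longrightarrow> y \<in> U)"
proof -
  let ?P = "\<lambda>U. U \<subseteq> V \<and> (\<forall>x\<in>U. \<exists>r>0. \<forall>y\<in>V. \<nu> (y - x) < r \<longrightarrow> y \<in> U)"
  have "?P (A \<inter> B)" if A: "?P A" and B: "?P B" for A B
  proof (intro conjI ballI)
    show "A \<inter> B \<subseteq> V" using A by blast
    fix x assume x: "x \<in> A \<inter> B"
    obtain r where "r > 0" "\<forall>y\<in>V. \<nu> (y - x) < r \<longrightarrow> y \<in> A" using A x by blast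
    moreover obtain q where "q > 0" "\<forall>y\<in>V. \<nu> (y - x) < q \<longrightarrow> y \<in> B" using B x by blast
    ultimately show "\<exists>r>0. \<forall>y\<in>V. \<nu> (y - x) < r \<longrightarrow> y \<in> A \<inter> B"
      by (intro exI[of _ "min r q"]) auto
  qed
  moreover have "?P (\<Union>K)" if "\<forall>U\<in>K. ?P U" for K
    using that by (meson Sup_le_iff UnionE UnionI)
  ultimately have "istopology ?P" unfolding istopology_def by blast
  then show ?thesis by (simp add: norm_topology_def topology_inverse')
qed

lemma norm_topology_UNIV:
  "norm_topology (UNIV :: 'a::real_normed_vector set) norm = euclidean"
  by (auto simp: topology_eq openin_norm_topology open_dist dist_norm)

lemma banach_space_on_UNIV: "banach_space_on (UNIV :: 'a::banach set) norm"
  unfolding banach_space_on_def normed_space_on_def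
proof (intro conjI allI ballI impI)
  fix s :: "nat \<Rightarrow> 'a" assume "\<forall>e>0. \<exists>N. \<forall>i\<ge>N. \<forall>j\<ge>N. norm (s i - s j) < e"
  then have "Cauchy s" by (simp add: Cauchy_def dist_norm)
  then obtain x where "s \<longlonglongrightarrow> x" by (auto simp: Cauchy_convergent_iff convergent_def)
  then show "\<exists>x\<in>UNIV. (\<lambda>k. norm (s k - x)) \<longlonglongrightarrow> 0"
    by (auto simp: LIM_zero_iff tendsto_norm_zero_iff)
qed (auto simp: norm_triangle_ineq)

lemma dual_space_UNIV:
  "dual_space (UNIV :: 'a::real_normed_vector set) norm = range blinfun_apply"
proof -
  have "f \<in> dual_space UNIV norm \<longleftrightarrow> bounded_linear f" for f :: "'a \<Rightarrow> real"
    by (auto simp: dual_space_def bounded_linear_def bounded_linear_axioms_def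
        linear_iff mult.commute)
  then show ?thesis
    by (auto simp: image_iff intro: blinfun.bounded_linear_right)
       (metis bounded_linear_Blinfun_apply)
qed

lemma dual_norm_UNIV:
  fixes g :: "'a::real_normed_vector \<Rightarrow>\<^sub>L real"
  shows "dual_norm UNIV norm (blinfun_apply g) = norm g"
proof -
  have le: "\<bar>g x\<bar> \<le> norm g" if "norm x \<le> 1" for x
    using norm_blinfun[of g x] mult_left_mono[OF that, of "norm g"] by simp
  then have bdd: "bdd_above ((\<lambda>x. \<bar>g x\<bar>) ` {x\<in>UNIV. norm x \<le> 1})"
    by (intro bdd_aboveI[of _ "norm g"]) auto
  let ?s = "dual_norm UNIV norm (blinfun_apply g)"
  have up: "\<bar>g x\<bar> \<le> ?s" if "norm x \<le> 1" for x
    unfolding dual_norm_def using that by (intro cSUP_upper bdd) auto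
  have "norm (g x) \<le> ?s * norm x" for x
  proof (cases "x = 0")
    case False
    then have "\<bar>g (x /\<^sub>R norm x)\<bar> \<le> ?s" by (intro up) simp
    with False show ?thesis by (simp add: blinfun.scaleR_right abs_mult field_simps)
  qed simp
  moreover have "0 \<le> ?s" using up[of 0] by simp
  ultimately have "norm g \<le> ?s" by (intro norm_blinfun_bound) auto
  moreover have "?s \<le> norm g"
    unfolding dual_norm_def by (rule cSUP_least) (use le in \<open>auto intro: exI[of _ 0]\<close>)
  ultimately show ?thesis by simp
qed

lemma norming_on_UNIV: "norming_on UNIV norm (blinfun_apply ` W) \<longleftrightarrow> norming W"
proof -
  have "{f \<in> blinfun_apply ` W. dual_norm UNIV norm f = 1} = blinfun_apply ` {g\<in>W. norm g = 1}"
    by (auto simp: dual_norm_UNIV)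
  then show ?thesis by (simp add: norming_on_def norming_def)
qed

end

theory Submission imports Defs
begin

text \<open>
  Both directions pass through operator ranges in \<open>Z = M\<^sup>*\<close>: linear subspaces \<open>R\<close> of \<open>Z\<close> that carry a
  complete norm \<open>\<nu>\<close> stronger than the norm of \<open>Z\<close>.
  
  Let \<open>T\<close> embed \<open>M\<close> onto a total nonnorming subspace of \<open>X\<^sup>*\<close>.  Evaluation \<open>(J x) m = T m x\<close> is a
  bounded operator \<open>X \<rightarrow> M\<^sup>*\<close>; it is injective because the subspace is total, not bounded below
  because the subspace is nonnorming, and \<open>J\<close> of the unit ball of \<open>X\<close> norms \<open>M\<close> because \<open>T\<close> is
  bounded below.  So \<open>R = J(X)\<close> is an operator range on which \<open>\<nu>\<close> and the norm of \<open>Z\<close> are not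
  equivalent.  The closure of \<open>R\<close> may well be all of \<open>Z\<close>, but \<open>R\<close> lies arbitrarily close to a closed
  subspace \<open>W\<close> of infinite codimension (\<open>operator_range_near_infinite_codimension\<close>), and a small
  perturbation does not destroy norming.  To find \<open>W\<close>, build a biorthogonal sequence of vectors \<open>f\<^sub>n\<close>
  with \<open>\<Sum>\<^sub>n \<parallel>f\<^sub>n\<parallel> \<le> \<epsilon>\<close> and functionals \<open>g\<^sub>n\<close> with \<open>\<bar>g\<^sub>n r\<bar> \<le> \<nu> r\<close> on \<open>R\<close>, and let \<open>W\<close> be the common kernel
  of the \<open>g\<^sub>n\<close>; then \<open>r - \<Sum>\<^sub>n g\<^sub>n(r) f\<^sub>n\<close> is a point of \<open>W\<close> within \<open>\<epsilon> \<nu> r\<close> of \<open>r\<close>.  The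
  sequence can always be prolonged: the obstruction would be a finite-dimensional \<open>F\<close> for which the
  unit ball of \<open>R\<close> plus \<open>F\<close> is dense in a ball of \<open>Z\<close>, and the argument of the open mapping theorem
  then makes \<open>\<nu>\<close> equivalent to the norm (\<open>finite_codim_range_bounded_below\<close>).  Apart from that
  obstruction, each new functional comes from the Hahn-Banach theorem (\<open>separating_functional\<close>).
  
  Conversely, let \<open>W\<close> be closed, norming and of infinite codimension.  The same construction, with
  \<open>R = W\<close> and the zero seminorm, gives a biorthogonal sequence with \<open>g\<^sub>n = 0\<close> on \<open>W\<close> and
  \<open>\<parallel>f\<^sub>n\<parallel> \<le> (1/2)\<^sup>n\<^sup>+\<^sup>1\<close>.  The space \<open>V\<close> of all \<open>w + \<Sum>\<^sub>n a\<^sub>n f\<^sub>n\<close> with \<open>w\<close> in \<open>W\<close> and \<open>a\<close> bounded, with the norm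
  of the pair \<open>(w, a)\<close>, is a Banach space \<open>X\<close> (\<open>infinite_codimension_enlargement\<close>).  The elements of
  \<open>M\<close> act on it by evaluation.  This embeds \<open>M\<close> isomorphically into \<open>X\<^sup>*\<close>, since already \<open>W\<close> is
  norming; the image is nonnorming, since it cannot see that \<open>f\<^sub>n\<close> has norm at least 1 in \<open>X\<close> while
  \<open>\<parallel>f\<^sub>n\<parallel>\<close> tends to 0.
\<close>

section \<open>Sublinear functionals and the Hahn-Banach theorem\<close>

text \<open>
  Only the inequality for \<open>t > 0\<close> is demanded, which is what one can verify directly for an infimum;
  equality follows by scaling with \<open>1 / t\<close>, and \<open>p 0 = 0\<close> from \<open>p 0 = p (2 0)\<close>.
\<close>

definition sublinear :: "('z::real_vector \<Rightarrow> real) \<Rightarrow> bool" where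
  "sublinear p \<longleftrightarrow> (\<forall>x y. p (x + y) \<le> p x + p y) \<and> (\<forall>t>0. \<forall>x. p (t *\<^sub>R x) \<le> t * p x)"

lemma sublinearD:
  assumes "sublinear p"
  shows sublinear_add: "p (x + y) \<le> p x + p y"
    and sublinear_scaleR: "t > 0 \<Longrightarrow> p (t *\<^sub>R x) = t * p x"
    and sublinear_zero: "p 0 = 0"
    and sublinear_minus: "- p (- x) \<le> p x"
proof -
  show add: "p (x + y) \<le> p x + p y" for x y
    using assms by (auto simp: sublinear_def)
  show scale: "p (t *\<^sub>R x) = t * p x" if t: "t > 0" for t x
  proof (rule antisym)
    have "p ((1 / t) *\<^sub>R (t *\<^sub>R x)) \<le> (1 / t) * p (t *\<^sub>R x)"
      using assms t unfolding sublinear_def by (meson zero_less_divide_1_iff)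
    with t show "t * p x \<le> p (t *\<^sub>R x)" by (simp add: field_simps)
    show "p (t *\<^sub>R x) \<le> t * p x" using assms t by (auto simp: sublinear_def)
  qed
  show zero: "p 0 = 0" using scale[of 2 0] by simp
  show "- p (- x) \<le> p x" using add[of x "- x"] zero by simp
qed

text \<open>
  Three infima have to be shown sublinear below: a one-parameter infimum, the infimum of a chain and an
  infimal convolution.  In each case the pairs above the graph form a convex cone \<open>A\<close>, and
  sublinearity of the lower envelope uses nothing else.
\<close>

lemma sublinear_lower_envelope:
  fixes A :: "'z::real_vector \<Rightarrow> real \<Rightarrow> bool"
  assumes add: "\<And>x y s t. A x s \<Longrightarrow> A y t \<Longrightarrow> A (x + y) (s + t)"
    and scale: "\<And>x s t. A x s \<Longrightarrow> t > 0 \<Longrightarrow> A (t *\<^sub>R x) (t * s)"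
    and nonempty: "\<And>x. \<exists>s. A x s"
    and lower: "\<And>x s. A x s \<Longrightarrow> b x \<le> s"
  shows "sublinear (\<lambda>x. Inf {s. A x s})"
    and "A x s \<Longrightarrow> Inf {s. A x s} \<le> s"
proof -
  have le: "Inf {s. A x s} \<le> s" if "A x s" for x s
    by (rule cInf_lower) (use that lower in \<open>auto intro!: bdd_belowI[of _ "b x"]\<close>)
  then show "A x s \<Longrightarrow> Inf {s. A x s} \<le> s" .
  have ge: "c \<le> Inf {s. A x s}" if "\<And>s. A x s \<Longrightarrow> c \<le> s" for x c
    by (rule cInf_greatest) (use that nonempty in auto)
  show "sublinear (\<lambda>x. Inf {s. A x s})"
    unfolding sublinear_def
  proof (intro conjI allI impI)
    fix x y
    have "Inf {s. A (x + y) s} - s \<le> Inf {t. A y t}" if "A x s" for s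
    proof (rule ge)
      fix t assume "A y t"
      from le[OF add[OF that this]] show "Inf {s. A (x + y) s} - s \<le> t" by simp
    qed
    then have "Inf {s. A (x + y) s} - Inf {t. A y t} \<le> Inf {s. A x s}"
      by (intro ge) (auto simp: algebra_simps)
    then show "Inf {s. A (x + y) s} \<le> Inf {s. A x s} + Inf {s. A y s}" by simp
  next
    fix t :: real and x assume t: "t > 0"
    have "Inf {s. A (t *\<^sub>R x) s} / t \<le> Inf {s. A x s}"
      by (rule ge) (use le[OF scale[OF _ t]] t in \<open>auto simp: field_simps\<close>)
    then show "Inf {s. A (t *\<^sub>R x) s} \<le> t * Inf {s. A x s}"
      using t by (simp add: field_simps)
  qed
qed

text \<open>
  \<open>q'\<close> is the infimum of \<open>q (x + t y) - t q y\<close> over \<open>t \<ge> 0\<close>; the two bounds are the instances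
  \<open>t = 0\<close> and \<open>t = 1\<close>.  A minimal sublinear functional must coincide with its \<open>q'\<close>, and is therefore
  superadditive.
\<close>

lemma sublinear_slope:
  fixes q :: "'z::real_vector \<Rightarrow> real"
  assumes q: "sublinear q"
  obtains q' where "sublinear q'" "\<And>x. q' x \<le> q x" "\<And>x. q' x \<le> q (x + y) - q y"
proof -
  define A where "A = (\<lambda>x s. \<exists>t\<ge>0. q (x + t *\<^sub>R y) - t * q y \<le> s)"
  have A_add: "A (x + x') (s + s')" if h: "A x s" "A x' s'" for x x' s s'
  proof -
    obtain t where t: "t \<ge> 0" "q (x + t *\<^sub>R y) - t * q y \<le> s"
      using h(1) unfolding A_def by blast
    obtain t' where t': "t' \<ge> 0" "q (x' + t' *\<^sub>R y) - t' * q y \<le> s'"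
      using h(2) unfolding A_def by blast
    have "q ((x + x') + (t + t') *\<^sub>R y) \<le> q (x + t *\<^sub>R y) + q (x' + t' *\<^sub>R y)"
      using sublinear_add[OF q, of "x + t *\<^sub>R y" "x' + t' *\<^sub>R y"]
      by (simp add: algebra_simps)
    with t t' show ?thesis
      unfolding A_def by (intro exI[of _ "t + t'"]) (auto simp: algebra_simps)
  qed
  have A_scale: "A (u *\<^sub>R x) (u * s)" if h: "A x s" and u: "u > 0" for x s u
  proof -
    obtain t where t: "t \<ge> 0" "q (x + t *\<^sub>R y) - t * q y \<le> s"
      using h unfolding A_def by blast
    have "q (u *\<^sub>R x + (u * t) *\<^sub>R y) = u * q (x + t *\<^sub>R y)"
      using sublinear_scaleR[OF q u, of "x + t *\<^sub>R y"] by (simp add: algebra_simps)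
    with t mult_left_mono[OF t(2), of u] u show ?thesis
      unfolding A_def by (intro exI[of _ "u * t"]) (auto simp: algebra_simps)
  qed
  have A_ne: "\<exists>s. A x s" for x unfolding A_def by (auto intro: exI[of _ 0])
  have A_low: "- q (- x) \<le> s" if h: "A x s" for x s
  proof -
    obtain t where t: "t \<ge> 0" "q (x + t *\<^sub>R y) - t * q y \<le> s"
      using h unfolding A_def by blast
    have "t * q y = q (t *\<^sub>R y)"
      using t(1) sublinear_scaleR[OF q, of t y] sublinear_zero[OF q] by (cases "t = 0") auto
    also have "\<dots> \<le> q (x + t *\<^sub>R y) + q (- x)"
      using sublinear_add[OF q, of "x + t *\<^sub>R y" "- x"] by simp
    finally show ?thesis using t(2) by simp
  qed
  show ?thesis
  proof (rule that)
    show "sublinear (\<lambda>x. Inf {s. A x s})"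
      by (rule sublinear_lower_envelope[OF A_add A_scale A_ne A_low])
    have le: "Inf {s. A x s} \<le> s" if "A x s" for x s
      by (rule sublinear_lower_envelope(2)[OF A_add A_scale A_ne A_low that])
    show "Inf {s. A x s} \<le> q x" for x
      by (rule le) (auto simp: A_def intro: exI[of _ 0])
    show "Inf {s. A x s} \<le> q (x + y) - q y" for x
      by (rule le) (auto simp: A_def intro: exI[of _ 1])
  qed
qed

text \<open>
  A minimal sublinear functional is linear.  Minimality is sought below the slope functional of \<open>p\<close>
  in the direction \<open>y\<close> instead of below \<open>p\<close> itself: its value at \<open>- y\<close> is at most \<open>- p y\<close>, which
  forces equality at \<open>y\<close>.
\<close>

theorem hahn_banach_sublinear:
  fixes p :: "'z::real_vector \<Rightarrow> real"
  assumes p: "sublinear p"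
  obtains h where "linear h" "\<And>x. h x \<le> p x" "h y = p y"
proof -
  obtain p0 where p0: "sublinear p0" "\<And>x. p0 x \<le> p x" "\<And>x. p0 x \<le> p (x + y) - p y"
    using sublinear_slope[OF p] by blast
  define S where "S = {q. sublinear q \<and> q \<le> p0}"
  have "\<exists>m\<in>S. \<forall>q\<in>S. q \<le> m \<longrightarrow> q = m"
  proof (rule predicate_Zorn)
    show "partial_order_on S (relation_of (\<lambda>q q'. q' \<le> q) S)"
      by (rule partial_order_on_relation_ofI) auto
    fix C assume "C \<in> Chains (relation_of (\<lambda>q q'. q' \<le> q) S)"
    then have CS: "C \<subseteq> S" and chain: "\<And>q q'. q \<in> C \<Longrightarrow> q' \<in> C \<Longrightarrow> q \<le> q' \<or> q' \<le> q"
      by (auto simp: Chains_def relation_of_def)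
    show "\<exists>u\<in>S. \<forall>q\<in>C. u \<le> q"
    proof (cases "C = {}")
      case True
      then show ?thesis using p0(1) by (auto simp: S_def)
    next
      case False
      define A where "A = (\<lambda>x s. \<exists>q\<in>C. q x \<le> s)"
      have A_add: "A (x + x') (s + s')" if h: "A x s" "A x' s'" for x x' s s'
      proof -
        obtain q where q: "q \<in> C" "q x \<le> s" using h(1) unfolding A_def by blast
        obtain q' where q': "q' \<in> C" "q' x' \<le> s'" using h(2) unfolding A_def by blast
        obtain m where m: "m \<in> C" "m \<le> q" "m \<le> q'" using chain[OF q(1) q'(1)] q q' by blast
        have "m (x + x') \<le> m x + m x'" using m CS by (auto simp: S_def intro: sublinear_add)
        also have "\<dots> \<le> s + s'" using m(2,3) q(2) q'(2) by (meson add_mono le_funD order_trans)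
        finally show ?thesis using m(1) unfolding A_def by blast
      qed
      have A_scale: "A (t *\<^sub>R x) (t * s)" if h: "A x s" "t > 0" for x s t
      proof -
        obtain q where q: "q \<in> C" "q x \<le> s" using h(1) unfolding A_def by blast
        then have "q (t *\<^sub>R x) = t * q x" using CS h(2) by (auto simp: S_def intro: sublinear_scaleR)
        with q h(2) show ?thesis unfolding A_def by (intro bexI[of _ q]) auto
      qed
      have A_ne: "\<exists>s. A x s" for x using False unfolding A_def by blast
      have A_low: "- p0 (- x) \<le> s" if h: "A x s" for x s
      proof -
        obtain q where q: "q \<in> C" "q x \<le> s" using h unfolding A_def by blast
        then have "sublinear q" "q (- x) \<le> p0 (- x)" using CS by (auto simp: S_def le_fun_def)
        with q(2) sublinear_minus[of q x] show ?thesis by linarith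
      qed
      let ?u = "\<lambda>x. Inf {s. A x s}"
      have u: "sublinear ?u" by (rule sublinear_lower_envelope[OF A_add A_scale A_ne A_low])
      have le: "?u \<le> q" if "q \<in> C" for q
        unfolding le_fun_def
        by (intro allI sublinear_lower_envelope(2)[OF A_add A_scale A_ne A_low])
           (use that in \<open>auto simp: A_def\<close>)
      moreover have "?u \<le> p0" using False le CS unfolding S_def by (blast intro: order_trans)
      ultimately show ?thesis using u unfolding S_def by blast
    qed
  qed
  then obtain h where h: "sublinear h" "h \<le> p0"
    and minimal: "\<And>q. sublinear q \<Longrightarrow> q \<le> h \<Longrightarrow> q = h"
    unfolding S_def using order_trans by blast
  have super: "h x + h z \<le> h (x + z)" for x z
  proof -
    obtain q where "sublinear q" "\<And>x. q x \<le> h x" "\<And>x. q x \<le> h (x + z) - h z"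
      using sublinear_slope[OF h(1)] by blast
    moreover from this have "q = h" by (intro minimal) (auto simp: le_fun_def)
    ultimately show ?thesis by (metis le_diff_eq)
  qed
  have add: "h (x + z) = h x + h z" for x z
    using super sublinear_add[OF h(1)] by (simp add: antisym)
  have minus: "h (- x) = - h x" for x
    using add[of x "- x"] sublinear_zero[OF h(1)] by simp
  have "h (t *\<^sub>R x) = t *\<^sub>R h x" for t x
    using sublinear_scaleR[OF h(1), of t x] sublinear_scaleR[OF h(1), of "- t" x]
      sublinear_zero[OF h(1)] minus[of "t *\<^sub>R x"]
    by (cases t "0::real" rule: linorder_cases) auto
  with add have "linear h" by (intro linearI)
  moreover have le: "h x \<le> p x" for x
    using h(2) p0(2)[of x] by (auto simp: le_fun_def intro: order_trans)
  moreover have "h y = p y"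
    using le[of y] le_funD[OF h(2), of "- y"] p0(3)[of "- y"] minus[of y] sublinear_zero[OF p] by simp
  ultimately show ?thesis using that by blast
qed

section \<open>Separation from a ball plus a subspace\<close>

definition seminorm_on :: "'z::real_vector set \<Rightarrow> ('z \<Rightarrow> real) \<Rightarrow> bool" where
  "seminorm_on R \<nu> \<longleftrightarrow> subspace R \<and> (\<forall>x\<in>R. 0 \<le> \<nu> x)
     \<and> (\<forall>r. \<forall>x\<in>R. \<nu> (r *\<^sub>R x) = \<bar>r\<bar> * \<nu> x)
     \<and> (\<forall>x\<in>R. \<forall>y\<in>R. \<nu> (x + y) \<le> \<nu> x + \<nu> y)"

lemma normed_space_onD:
  assumes "normed_space_on V \<nu>"
  shows normed_space_on_seminorm: "seminorm_on V \<nu>"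
    and normed_space_on_eq_zero: "x \<in> V \<Longrightarrow> \<nu> x = 0 \<longleftrightarrow> x = 0"
  using assms by (auto simp: normed_space_on_def seminorm_on_def)

lemma banach_space_on_seminorm: "banach_space_on R \<nu> \<Longrightarrow> seminorm_on R \<nu>"
  by (auto simp: banach_space_on_def intro: normed_space_on_seminorm)

lemma seminorm_onD:
  assumes "seminorm_on R \<nu>"
  shows seminorm_on_subspace: "subspace R"
    and seminorm_on_nonneg: "x \<in> R \<Longrightarrow> 0 \<le> \<nu> x"
    and seminorm_on_scaleR: "x \<in> R \<Longrightarrow> \<nu> (t *\<^sub>R x) = \<bar>t\<bar> * \<nu> x"
    and seminorm_on_add: "x \<in> R \<Longrightarrow> y \<in> R \<Longrightarrow> \<nu> (x + y) \<le> \<nu> x + \<nu> y"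
    and seminorm_on_zero: "\<nu> 0 = 0"
    and seminorm_on_minus: "x \<in> R \<Longrightarrow> \<nu> (- x) = \<nu> x"
    and seminorm_on_diff: "x \<in> R \<Longrightarrow> y \<in> R \<Longrightarrow> \<nu> (x - y) \<le> \<nu> x + \<nu> y"
proof -
  show sub: "subspace R" and "x \<in> R \<Longrightarrow> 0 \<le> \<nu> x"
    and sc: "\<And>x t. x \<in> R \<Longrightarrow> \<nu> (t *\<^sub>R x) = \<bar>t\<bar> * \<nu> x"
    and add: "\<And>x y. x \<in> R \<Longrightarrow> y \<in> R \<Longrightarrow> \<nu> (x + y) \<le> \<nu> x + \<nu> y"
    using assms by (auto simp: seminorm_on_def)
  show "\<nu> 0 = 0" using sc[of 0 0] subspace_0[OF sub] by simp
  show minus: "\<nu> (- x) = \<nu> x" if "x \<in> R" for x using sc[OF that, of "- 1"] by simp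
  show "\<nu> (x - y) \<le> \<nu> x + \<nu> y" if "x \<in> R" "y \<in> R"
    using add[OF that(1) subspace_neg[OF sub that(2)]] minus[OF that(2)] by simp
qed

lemma seminorm_on_sum:
  assumes R: "seminorm_on R \<nu>" and "\<And>i. i \<in> I \<Longrightarrow> x i \<in> R"
  shows "\<nu> (\<Sum>i\<in>I. x i) \<le> (\<Sum>i\<in>I. \<nu> (x i))"
  using assms(2)
proof (induction I rule: infinite_finite_induct)
  case (insert i I)
  then have "(\<Sum>i\<in>I. x i) \<in> R" by (intro subspace_sum seminorm_on_subspace[OF R]) auto
  then show ?case
    using insert seminorm_on_add[OF R, of "x i" "\<Sum>i\<in>I. x i"] by fastforce
qed (auto simp: seminorm_on_zero[OF R])

text \<open>
  Hahn-Banach applied to the infimal convolution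
  \<open>p z = inf {\<nu> r + \<parallel>z - r - u\<parallel> / \<rho> | r \<in> R, u \<in> F}\<close>.  It is at most \<open>\<parallel>z\<parallel> / \<rho>\<close>, at most \<open>\<nu>\<close> on \<open>R\<close>
  and at most \<open>0\<close> on \<open>F\<close>.  It is at least \<open>1\<close> at \<open>y\<close>: either \<open>\<nu> r > 1\<close>, or \<open>r\<close> lies in the unit
  ball and the second summand is at least \<open>1\<close>.
\<close>

lemma separating_functional:
  fixes R F :: "'z::real_normed_vector set"
  assumes R: "seminorm_on R \<nu>" and F: "subspace F" and "\<rho> > 0"
    and far: "\<And>r u. r \<in> R \<Longrightarrow> \<nu> r \<le> 1 \<Longrightarrow> u \<in> F \<Longrightarrow> \<rho> \<le> norm (y - r - u)"
  obtains h :: "'z \<Rightarrow>\<^sub>L real"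
  where "h y \<ge> 1" "\<And>u. u \<in> F \<Longrightarrow> h u = 0" "\<And>r. r \<in> R \<Longrightarrow> \<bar>h r\<bar> \<le> \<nu> r"
proof -
  have sR: "subspace R" and pos: "\<And>x. x \<in> R \<Longrightarrow> 0 \<le> \<nu> x"
    and hom: "\<And>r x. x \<in> R \<Longrightarrow> \<nu> (r *\<^sub>R x) = \<bar>r\<bar> * \<nu> x"
    and tri: "\<And>x y. x \<in> R \<Longrightarrow> y \<in> R \<Longrightarrow> \<nu> (x + y) \<le> \<nu> x + \<nu> y"
    using R by (auto simp: seminorm_on_def)
  have \<nu>0: "\<nu> 0 = 0" using hom[of 0 0] subspace_0[OF sR] by simp
  define A where "A = (\<lambda>z s. \<exists>r\<in>R. \<exists>u\<in>F. \<nu> r + norm (z - r - u) / \<rho> \<le> s)"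
  have A_add: "A (z + z') (s + s')" if h: "A z s" "A z' s'" for z z' s s'
  proof -
    obtain r u where ru: "r \<in> R" "u \<in> F" "\<nu> r + norm (z - r - u) / \<rho> \<le> s"
      using h(1) unfolding A_def by blast
    obtain r' u' where ru': "r' \<in> R" "u' \<in> F" "\<nu> r' + norm (z' - r' - u') / \<rho> \<le> s'"
      using h(2) unfolding A_def by blast
    have "norm ((z + z') - (r + r') - (u + u')) \<le> norm (z - r - u) + norm (z' - r' - u')"
      using norm_triangle_ineq[of "z - r - u" "z' - r' - u'"] by (simp add: algebra_simps)
    then have "norm ((z + z') - (r + r') - (u + u')) / \<rho>
        \<le> norm (z - r - u) / \<rho> + norm (z' - r' - u') / \<rho>"
      using \<open>\<rho> > 0\<close> by (simp add: divide_right_mono flip: add_divide_distrib)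
    then have "\<nu> (r + r') + norm ((z + z') - (r + r') - (u + u')) / \<rho> \<le> s + s'"
      using ru(3) ru'(3) tri[OF ru(1) ru'(1)] by linarith
    then show ?thesis
      unfolding A_def using subspace_add[OF sR ru(1) ru'(1)] subspace_add[OF F ru(2) ru'(2)] by blast
  qed
  have A_scale: "A (t *\<^sub>R z) (t * s)" if h: "A z s" and t: "t > 0" for z s t
  proof -
    obtain r u where ru: "r \<in> R" "u \<in> F" "\<nu> r + norm (z - r - u) / \<rho> \<le> s"
      using h unfolding A_def by blast
    have "norm (t *\<^sub>R z - t *\<^sub>R r - t *\<^sub>R u) = t * norm (z - r - u)"
      using t by (simp flip: scaleR_diff_right)
    then have "\<nu> (t *\<^sub>R r) + norm (t *\<^sub>R z - t *\<^sub>R r - t *\<^sub>R u) / \<rho> \<le> t * s"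
      using mult_left_mono[OF ru(3), of t] hom[OF ru(1)] t by (simp add: algebra_simps)
    then show ?thesis
      unfolding A_def using subspace_scale[OF sR ru(1)] subspace_scale[OF F ru(2)] by blast
  qed
  have A_ne: "\<exists>s. A z s" for z unfolding A_def using subspace_0[OF sR] subspace_0[OF F] by blast
  have A_low: "0 \<le> s" if A: "A z s" for z s
  proof -
    obtain r u where "r \<in> R" "\<nu> r + norm (z - r - u) / \<rho> \<le> s"
      using A unfolding A_def by blast
    moreover have "0 \<le> norm (z - r - u) / \<rho>" using \<open>\<rho> > 0\<close> by simp
    ultimately show ?thesis using pos[of r] by linarith
  qed
  define p where "p = (\<lambda>z. Inf {s. A z s})"
  have p_sub: "sublinear p"
    unfolding p_def by (rule sublinear_lower_envelope[OF A_add A_scale A_ne A_low])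
  have p_le: "p z \<le> s" if "A z s" for z s
    unfolding p_def by (rule sublinear_lower_envelope(2)[OF A_add A_scale A_ne A_low that])
  have p_y: "1 \<le> p y"
    unfolding p_def
  proof (rule cInf_greatest)
    show "{s. A y s} \<noteq> {}" using A_ne by blast
    fix s assume "s \<in> {s. A y s}"
    then obtain r u where ru: "r \<in> R" "u \<in> F" "\<nu> r + norm (y - r - u) / \<rho> \<le> s"
      unfolding A_def by blast
    show "1 \<le> s"
    proof (cases "\<nu> r \<le> 1")
      case True
      then have "1 \<le> norm (y - r - u) / \<rho>" using far[OF ru(1) True ru(2)] \<open>\<rho> > 0\<close> by simp
      with ru(3) pos[OF ru(1)] show ?thesis by linarith
    next
      case False
      moreover have "0 \<le> norm (y - r - u) / \<rho>" using \<open>\<rho> > 0\<close> by simp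
      ultimately show ?thesis using ru(3) by linarith
    qed
  qed
  have p_norm: "p z \<le> norm z / \<rho>" for z
    by (rule p_le) (use subspace_0[OF sR] subspace_0[OF F] \<nu>0 in \<open>force simp: A_def\<close>)
  have p_F: "p u \<le> 0" if "u \<in> F" for u
    by (rule p_le) (use subspace_0[OF sR] that \<nu>0 in \<open>force simp: A_def\<close>)
  have p_R: "p r \<le> \<nu> r" if "r \<in> R" for r
    by (rule p_le) (use subspace_0[OF F] that in \<open>force simp: A_def\<close>)
  obtain h where h: "linear h" "\<And>x. h x \<le> p x" "h y = p y"
    using hahn_banach_sublinear[OF p_sub] by blast
  have neg: "h (- x) = - h x" for x using linear_neg[OF h(1)] .
  have "bounded_linear h"
    using h(1) unfolding bounded_linear_def bounded_linear_axioms_def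
  proof (intro conjI exI[of _ "1 / \<rho>"] allI)
    show "norm (h x) \<le> norm x * (1 / \<rho>)" for x
      using h(2)[of x] h(2)[of "- x"] p_norm[of x] p_norm[of "- x"] neg[of x] by auto
  qed
  then have app: "Blinfun h x = h x" for x by (simp add: bounded_linear_Blinfun_apply)
  show ?thesis
  proof (rule that[of "Blinfun h"])
    show "1 \<le> Blinfun h y" using p_y h(3) app by simp
    show "Blinfun h u = 0" if "u \<in> F" for u
      using h(2)[of u] h(2)[of "- u"] p_F[OF that] p_F[of "- u"] subspace_neg[OF F that] neg[of u] app
      by auto
    show "\<bar>Blinfun h r\<bar> \<le> \<nu> r" if r: "r \<in> R" for r
      using h(2)[of r] h(2)[of "- r"] p_R[OF r] p_R[of "- r"] subspace_neg[OF sR r] neg[of r]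
        hom[OF r, of "- 1"] app
      by auto
  qed
qed

section \<open>Biorthogonal sequences\<close>

text \<open>
  Given the first \<open>n\<close> pairs, separate a small \<open>y\<close> from the unit ball of \<open>R\<close> plus the span of
  \<open>f\<^sub>0, ..., f\<^sub>n\<^sub>-\<^sub>1\<close> by a functional \<open>h\<close>, which then vanishes on the old vectors.  Subtracting
  \<open>\<Sum>\<^sub>i g\<^sub>i(y) f\<^sub>i\<close> from \<open>y\<close> makes it invisible to the old functionals without changing \<open>h y \<ge> 1\<close>.  The
  norm grows at most by a factor that depends on the first \<open>n\<close> pairs only, so \<open>y\<close> can be chosen small
  enough in advance.  The hypothesis \<open>far\<close> isolates the only point at which the two applications differ.
\<close>

lemma biorthogonal_sequence:
  fixes R :: "'z::real_normed_vector set"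
  assumes R: "seminorm_on R \<nu>" and e: "\<And>n::nat. e n > 0"
    and far: "\<And>n f (g :: nat \<Rightarrow> 'z \<Rightarrow>\<^sub>L real) d.
      \<lbrakk>\<forall>i<n. \<forall>j<n. g i (f j) = (if i = j then 1 else 0); \<forall>i<n. \<forall>r\<in>R. \<bar>g i r\<bar> \<le> \<nu> r; d > 0\<rbrakk>
      \<Longrightarrow> \<exists>y \<rho>. norm y \<le> d \<and> \<rho> > 0
            \<and> (\<forall>r\<in>R. \<nu> r \<le> 1 \<longrightarrow> (\<forall>u\<in>span (f ` {..<n}). \<rho> \<le> norm (y - r - u)))"
  obtains f and g :: "nat \<Rightarrow> 'z \<Rightarrow>\<^sub>L real"
  where "\<And>i j. g i (f j) = (if i = j then 1 else 0)" "\<And>n. norm (f n) \<le> e n"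
    "\<And>n r. r \<in> R \<Longrightarrow> \<bar>g n r\<bar> \<le> \<nu> r"
proof -
  define P :: "(nat \<Rightarrow> 'z \<times> ('z \<Rightarrow>\<^sub>L real)) \<Rightarrow> nat \<Rightarrow> 'z \<times> ('z \<Rightarrow>\<^sub>L real) \<Rightarrow> bool" where
    "P = (\<lambda>s n (x, h). norm x \<le> e n \<and> (\<forall>r\<in>R. \<bar>h r\<bar> \<le> \<nu> r) \<and> h x = 1
        \<and> (\<forall>i<n. h (fst (s i)) = 0 \<and> blinfun_apply (snd (s i)) x = 0))"
  have "\<exists>s. \<forall>n. P s n (s n)"
  proof (rule dependent_wellorder_choice)
    fix r n and s t :: "nat \<Rightarrow> 'z \<times> ('z \<Rightarrow>\<^sub>L real)"
    assume "\<And>i. i < n \<Longrightarrow> s i = t i"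
    then show "P s n r = P t n r" unfolding P_def by (cases r) simp
  next
    fix n and s :: "nat \<Rightarrow> 'z \<times> ('z \<Rightarrow>\<^sub>L real)"
    assume IH: "\<And>i. i < n \<Longrightarrow> P s i (s i)"
    define f where "f i = fst (s i)" for i
    define g where "g i = snd (s i)" for i
    have IH': "norm (f i) \<le> e i" "\<forall>r\<in>R. \<bar>g i r\<bar> \<le> \<nu> r" "g i (f i) = 1"
        "\<forall>j<i. g i (f j) = 0 \<and> g j (f i) = 0" if "i < n" for i
      using IH[OF that] unfolding P_def f_def g_def by (auto simp: split_beta)
    have bi: "\<forall>i<n. \<forall>j<n. g i (f j) = (if i = j then 1 else 0)"
      using IH'(3,4) by (metis nat_neq_iff)
    \<comment> \<open>bound for the norm of the projection \<open>y \<mapsto> y - \<Sum>\<^sub>i g\<^sub>i(y) f\<^sub>i\<close>\<close>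
    define D where "D = 1 + (\<Sum>i<n. norm (g i) * norm (f i))"
    have "D \<ge> 1" unfolding D_def by (simp add: sum_nonneg)
    then have "e n / D > 0" using e[of n] by simp
    then obtain y \<rho> where y: "norm y \<le> e n / D" "\<rho> > 0"
      and sep: "\<forall>r\<in>R. \<nu> r \<le> 1 \<longrightarrow> (\<forall>u\<in>span (f ` {..<n}). \<rho> \<le> norm (y - r - u))"
      using far[OF bi] IH'(2) by metis
    obtain h :: "'z \<Rightarrow>\<^sub>L real" where h: "h y \<ge> 1" "\<And>u. u \<in> span (f ` {..<n}) \<Longrightarrow> h u = 0"
        "\<And>r. r \<in> R \<Longrightarrow> \<bar>h r\<bar> \<le> \<nu> r"
      using separating_functional[OF R subspace_span y(2)] sep by metis
    have hf: "h (f i) = 0" if "i < n" for i using h(2) that by (simp add: span_base)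
    define z where "z = y - (\<Sum>i<n. g i y *\<^sub>R f i)"
    have hz: "h z = h y" using hf by (simp add: z_def blinfun.diff_right blinfun.sum_right blinfun.scaleR_right)
    have gz: "g i z = 0" if "i < n" for i
    proof -
      have "(\<Sum>j<n. g j y * g i (f j)) = (\<Sum>j<n. if j = i then g i y else 0)"
        using bi that by (intro sum.cong) auto
      also have "\<dots> = g i y" using that by simp
      finally show ?thesis
        by (simp add: z_def blinfun.diff_right blinfun.sum_right blinfun.scaleR_right)
    qed
    have "norm (\<Sum>i<n. g i y *\<^sub>R f i) \<le> (\<Sum>i<n. (norm (g i) * norm (f i)) * norm y)"
    proof (rule sum_norm_le)
      fix i
      show "norm (g i y *\<^sub>R f i) \<le> norm (g i) * norm (f i) * norm y"
        using mult_right_mono[OF norm_blinfun[of "g i" y], of "norm (f i)"]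
        by (simp add: mult_ac)
    qed
    then have "norm z \<le> D * norm y"
      using norm_triangle_ineq4[of y "\<Sum>i<n. g i y *\<^sub>R f i"]
      by (simp add: z_def D_def algebra_simps flip: sum_distrib_left sum_distrib_right)
    also have "\<dots> \<le> e n" using y(1) \<open>D \<ge> 1\<close> by (simp add: field_simps)
    finally have nz: "norm z \<le> e n" .
    have "norm (z /\<^sub>R h y) \<le> e n"
      using nz h(1) mult_mono[of "inverse (h y)" 1 "norm z" "e n"] by (simp add: inverse_le_1_iff)
    then have "P s n (z /\<^sub>R h y, h)"
      using h hz gz hf unfolding P_def f_def g_def by (auto simp: blinfun.scaleR_right)
    then show "\<exists>r. P s n r" by blast
  qed
  then obtain s where s: "\<And>n. P s n (s n)" by blast
  have *: "norm (fst (s n)) \<le> e n" "\<forall>r\<in>R. \<bar>blinfun_apply (snd (s n)) r\<bar> \<le> \<nu> r"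
      "blinfun_apply (snd (s n)) (fst (s n)) = 1"
      "\<forall>i<n. blinfun_apply (snd (s n)) (fst (s i)) = 0 \<and> blinfun_apply (snd (s i)) (fst (s n)) = 0" for n
    using s[of n] unfolding P_def by (auto simp: split_beta)
  show ?thesis
    by (rule that[of "\<lambda>n. snd (s n)" "\<lambda>n. fst (s n)"]) (use * in \<open>auto\<close>, metis nat_neq_iff)
qed

lemma biorthogonal_expansion:
  fixes f :: "nat \<Rightarrow> 'z::real_vector"
  assumes lin: "\<And>i. i < n \<Longrightarrow> linear (g i)"
    and bi: "\<forall>i<n. \<forall>j<n. g i (f j) = (if i = j then 1 else (0::real))"
    and u: "u \<in> span (f ` {..<n})"
  shows "u = (\<Sum>i<n. g i u *\<^sub>R f i)"
  using u
proof (rule span_induct)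
  show "subspace {u. u = (\<Sum>i<n. g i u *\<^sub>R f i)}"
  proof (rule subspaceI; unfold mem_Collect_eq)
    show "0 = (\<Sum>i<n. g i 0 *\<^sub>R f i)" using lin by (simp add: linear_0)
  next
    fix x y
    assume x: "x = (\<Sum>i<n. g i x *\<^sub>R f i)" and y: "y = (\<Sum>i<n. g i y *\<^sub>R f i)"
    have "(\<Sum>i<n. g i (x + y) *\<^sub>R f i) = (\<Sum>i<n. g i x *\<^sub>R f i + g i y *\<^sub>R f i)"
      using lin by (intro sum.cong) (auto simp: linear_add scaleR_add_left)
    then show "x + y = (\<Sum>i<n. g i (x + y) *\<^sub>R f i)" using x y by (simp add: sum.distrib)
  next
    fix x and c :: real
    assume x: "x = (\<Sum>i<n. g i x *\<^sub>R f i)"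
    have "(\<Sum>i<n. g i (c *\<^sub>R x) *\<^sub>R f i) = (\<Sum>i<n. c *\<^sub>R (g i x *\<^sub>R f i))"
      using lin by (intro sum.cong) (auto simp: linear_cmul)
    also have "\<dots> = c *\<^sub>R x" by (subst (2) x) (rule scaleR_sum_right[symmetric])
    finally show "c *\<^sub>R x = (\<Sum>i<n. g i (c *\<^sub>R x) *\<^sub>R f i)" ..
  qed
  fix x assume "x \<in> f ` {..<n}"
  then obtain j where j: "j < n" "x = f j" by blast
  have "(\<Sum>i<n. g i x *\<^sub>R f i) = (\<Sum>i<n. if i = j then f j else 0)"
    using bi j by (intro sum.cong) auto
  then show "x = (\<Sum>i<n. g i x *\<^sub>R f i)" using j by simp
qed

text \<open>
  The coordinates \<open>z \<mapsto> (g\<^sub>i z)\<^sub>i\<close> map \<open>W\<close> to \<open>0\<close> and the \<open>f\<^sub>j\<close> to the unit sequences, so a finite set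
  spanning modulo \<open>W\<close> would span more independent sequences than it has elements.
\<close>

lemma infinite_codimension_if_biorthogonal:
  fixes f :: "nat \<Rightarrow> 'z::real_vector"
  assumes lin: "\<And>n. linear (g n)"
    and bi: "\<And>i j. g i (f j) = (if i = j then 1 else (0::real))"
    and W: "\<And>n w. w \<in> W \<Longrightarrow> g n w = 0"
  shows "infinite_codimension W"
  unfolding infinite_codimension_def
proof
  assume "\<exists>F. finite F \<and> span (W \<union> F) = UNIV"
  then obtain F where F: "finite F" "span (W \<union> F) = UNIV" by blast
  define G where "G = (\<lambda>z i. g i z)"
  define u :: "nat \<Rightarrow> nat \<Rightarrow> real" where "u = (\<lambda>j i. if i = j then 1 else (0::real))"
  have G: "linear G"
    by (rule linearI) (auto simp: G_def scaleR_fun_def linear_add[OF lin] linear_cmul[OF lin])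
  have inj: "inj u" by (rule injI) (metis u_def zero_neq_one)
  have indep: "independent (u ` {..card F})"
    unfolding dependent_def
  proof (intro notI, elim bexE)
    fix a assume "a \<in> u ` {..card F}" and a: "a \<in> span (u ` {..card F} - {a})"
    then obtain j where j: "a = u j" by blast
    have "a j = 0"
      using a
    proof (rule span_induct)
      show "subspace {v. v j = (0::real)}" by (auto simp: subspace_def scaleR_fun_def)
      show "v j = 0" if "v \<in> u ` {..card F} - {a}" for v using that j by (auto simp: u_def)
    qed
    then show False by (simp add: j u_def)
  qed
  have "u ` {..card F} \<subseteq> span (G ` F)"
  proof
    fix a assume "a \<in> u ` {..card F}"
    then obtain j where "a = u j" by blast
    then have "a = G (f j)" by (auto simp: u_def G_def bi)
    then have "a \<in> G ` span (W \<union> F)" using F(2) by simp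
    then have "a \<in> span (G ` (W \<union> F))" using linear_span_image[OF G] by simp
    also have "\<dots> \<subseteq> span (insert 0 (G ` F))"
      by (rule span_mono) (auto simp: G_def W)
    finally show "a \<in> span (G ` F)" by simp
  qed
  then have "card (u ` {..card F}) \<le> card (G ` F)"
    using independent_span_bound[OF _ indep] F(1) by blast
  also have "\<dots> \<le> card F" by (rule card_image_le[OF F(1)])
  finally show False using card_image[OF inj_on_subset[OF inj subset_UNIV]] by simp
qed

text \<open>
  The sum is the preimage of \<open>W\<close> under the continuous projection \<open>z \<mapsto> z - \<Sum>\<^sub>i g\<^sub>i(z) f\<^sub>i\<close>.
\<close>

lemma closed_sum_biorthogonal_span:
  fixes W :: "'z::real_normed_vector set" and g :: "nat \<Rightarrow> 'z \<Rightarrow>\<^sub>L real"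
  assumes W: "subspace W" "closed W" and gW: "\<And>i w. i < n \<Longrightarrow> w \<in> W \<Longrightarrow> g i w = 0"
    and bi: "\<forall>i<n. \<forall>j<n. g i (f j) = (if i = j then 1 else 0)"
  shows "closed {w + u | w u. w \<in> W \<and> u \<in> span (f ` {..<n})}"
proof -
  let ?P = "\<lambda>z. z - (\<Sum>i<n. g i z *\<^sub>R f i)"
  have "{w + u | w u. w \<in> W \<and> u \<in> span (f ` {..<n})} = ?P -` W"
  proof (intro set_eqI iffI)
    fix z assume "z \<in> {w + u | w u. w \<in> W \<and> u \<in> span (f ` {..<n})}"
    then obtain w u where z: "z = w + u" "w \<in> W" "u \<in> span (f ` {..<n})" by blast
    have "(\<Sum>i<n. g i z *\<^sub>R f i) = (\<Sum>i<n. g i u *\<^sub>R f i)"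
      using gW z by (intro sum.cong) (auto simp: blinfun.add_right)
    also have "\<dots> = u"
      using biorthogonal_expansion[of n "\<lambda>i. blinfun_apply (g i)", OF _ bi z(3)]
      by (simp add: blinfun.bounded_linear_right bounded_linear.linear)
    finally show "z \<in> ?P -` W" using z by simp
  next
    fix z assume "z \<in> ?P -` W"
    moreover have "(\<Sum>i<n. g i z *\<^sub>R f i) \<in> span (f ` {..<n})"
      by (intro span_sum span_scale span_base) auto
    moreover have "z = ?P z + (\<Sum>i<n. g i z *\<^sub>R f i)" by simp
    ultimately show "z \<in> {w + u | w u. w \<in> W \<and> u \<in> span (f ` {..<n})}" by blast
  qed
  moreover have "closed (?P -` W)"
    by (intro closed_vimage W continuous_intros)
  ultimately show ?thesis by simp
qed

section \<open>Banach spaces carried by a subspace\<close>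

lemma banach_space_on_complete_subspace:
  fixes S :: "'z::real_normed_vector set"
  assumes "subspace S" "complete S"
  shows "banach_space_on S norm"
  unfolding banach_space_on_def normed_space_on_def
proof (intro conjI allI impI)
  fix s :: "nat \<Rightarrow> 'z"
  assume s: "\<forall>k. s k \<in> S" and "\<forall>e>0. \<exists>N. \<forall>i\<ge>N. \<forall>j\<ge>N. norm (s i - s j) < e"
  then have "Cauchy s" by (simp add: Cauchy_def dist_norm)
  then obtain x where "x \<in> S" "s \<longlonglongrightarrow> x" using s assms(2) unfolding complete_def by blast
  then show "\<exists>x\<in>S. (\<lambda>k. norm (s k - x)) \<longlonglongrightarrow> 0"
    by (auto simp: LIM_zero_iff tendsto_norm_zero_iff)
qed (use assms in \<open>auto simp: norm_triangle_ineq\<close>)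

lemma complete_Times:
  fixes A :: "'a::metric_space set" and B :: "'b::metric_space set"
  assumes "complete A" "complete B"
  shows "complete (A \<times> B)"
  unfolding complete_def
proof (intro allI impI)
  fix s assume s: "(\<forall>n. s n \<in> A \<times> B) \<and> Cauchy s"
  then have "Cauchy (\<lambda>n. fst (s n))" "Cauchy (\<lambda>n. snd (s n))"
    by (auto intro: Cauchy_fst Cauchy_snd)
  with s assms obtain a b where "a \<in> A" "(\<lambda>n. fst (s n)) \<longlonglongrightarrow> a" "b \<in> B" "(\<lambda>n. snd (s n)) \<longlonglongrightarrow> b"
    unfolding complete_def by (metis mem_Times_iff)
  then show "\<exists>l\<in>A \<times> B. s \<longlonglongrightarrow> l"
    using tendsto_Pair[of "\<lambda>n. fst (s n)" a sequentially "\<lambda>n. snd (s n)" b]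
    by (intro bexI[of _ "(a, b)"]) auto
qed

text \<open>
  Over the discrete domain \<open>nat\<close> this is the completeness of \<open>\<ell>\<^sup>\<infinity>\<close>.
\<close>

lemma complete_UNIV_bcontfun:
  "complete (UNIV :: ('a::topological_space \<Rightarrow>\<^sub>C 'b::complete_space) set)"
  unfolding complete_def
proof (intro allI impI)
  fix s :: "nat \<Rightarrow> 'a \<Rightarrow>\<^sub>C 'b"
  assume s: "(\<forall>n. s n \<in> UNIV) \<and> Cauchy s"
  have "uniformly_convergent_on UNIV (\<lambda>n. apply_bcontfun (s n))"
    unfolding uniformly_convergent_eq_Cauchy uniformly_Cauchy_on_def
    using s unfolding Cauchy_def by (meson dist_fun_lt_imp_dist_val_lt)
  then obtain l where "uniform_limit UNIV (\<lambda>n. apply_bcontfun (s n)) l sequentially"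
    unfolding uniformly_convergent_on_def by blast
  then obtain l' where "s \<longlonglongrightarrow> l'"
    by (rule uniform_limit_bcontfunE) auto
  then show "\<exists>l\<in>UNIV. s \<longlonglongrightarrow> l" by auto
qed

text \<open>
  Transport of a complete norm along an injection.  It turns a Banach space that is mapped
  injectively into \<open>Z\<close> into a subspace of \<open>Z\<close> with a norm of its own.
\<close>

lemma banach_space_on_image:
  fixes J :: "'x::real_vector \<Rightarrow> 'y::real_vector"
  assumes V: "banach_space_on V \<nu>" and inj: "inj_on J V"
    and add: "\<And>x y. x \<in> V \<Longrightarrow> y \<in> V \<Longrightarrow> J (x + y) = J x + J y"
    and scale: "\<And>t x. x \<in> V \<Longrightarrow> J (t *\<^sub>R x) = t *\<^sub>R J x"
  shows "banach_space_on (J ` V) (\<lambda>y. \<nu> (inv_into V J y))"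
proof -
  let ?I = "inv_into V J"
  have I[simp]: "?I (J x) = x" if "x \<in> V" for x using inj that by simp
  have N: "normed_space_on V \<nu>" using V by (simp add: banach_space_on_def)
  then have sub: "subspace V" by (simp add: normed_space_on_def)
  have J0: "J 0 = 0" using scale[OF subspace_0[OF sub], of 0] by simp
  have mem: "x + y \<in> V" "t *\<^sub>R x \<in> V" "x - y \<in> V" if "x \<in> V" "y \<in> V" for x y t
    using that sub by (auto intro: subspace_add subspace_scale subspace_diff)
  have I_add: "?I (J x + J y) = x + y" if "x \<in> V" "y \<in> V" for x y
    using I[OF mem(1)[OF that]] add[OF that] by simp
  have I_scale: "?I (t *\<^sub>R J x) = t *\<^sub>R x" if "x \<in> V" for x t
    using I[OF mem(2)[OF that that]] scale[OF that] by simp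
  have I_diff: "?I (J x - J y) = x - y" if "x \<in> V" "y \<in> V" for x y
    using I_add[OF that(1) mem(2)[OF that(2,2)], of "-1"] scale[OF that(2), of "- 1"] by simp
  have "subspace (J ` V)"
    unfolding subspace_def
    using J0 subspace_0[OF sub] mem add scale by (auto simp: image_iff) metis+
  moreover have "J x = 0 \<longleftrightarrow> x = 0" if "x \<in> V" for x
    using inj_onD[OF inj, of x 0] J0 subspace_0[OF sub] that by auto
  ultimately have "normed_space_on (J ` V) (\<lambda>y. \<nu> (?I y))"
    using N unfolding normed_space_on_def by (auto simp: I_add I_scale)
  moreover have "\<exists>y\<in>J ` V. (\<lambda>k. \<nu> (?I (s k - y))) \<longlonglongrightarrow> 0"
    if s: "\<forall>k. s k \<in> J ` V" and cau: "\<forall>e>0. \<exists>N. \<forall>i\<ge>N. \<forall>j\<ge>N. \<nu> (?I (s i - s j)) < e" for s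
  proof -
    obtain t where t: "\<And>k. t k \<in> V" "\<And>k. s k = J (t k)"
      using s unfolding image_iff by metis
    have "\<forall>e>0. \<exists>N. \<forall>i\<ge>N. \<forall>j\<ge>N. \<nu> (t i - t j) < e"
      using cau t by (simp add: I_diff)
    then obtain x where "x \<in> V" "(\<lambda>k. \<nu> (t k - x)) \<longlonglongrightarrow> 0"
      using V t(1) unfolding banach_space_on_def by blast
    then show ?thesis using t by (auto simp: I_diff intro!: bexI[of _ "J x"])
  qed
  ultimately show ?thesis unfolding banach_space_on_def by blast
qed

section \<open>Operator ranges\<close>

text \<open>
  The iteration in the proof of the open mapping theorem, modulo \<open>F\<close>.  Halving the error at each step
  makes the partial sums of the corrections from \<open>R\<close> Cauchy for \<open>\<nu>\<close>, with total norm at most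
  \<open>1 + 1/2 + 1/4 + ... = 2\<close>; the contributions from \<open>F\<close> need not converge by themselves, but their
  sum is recovered as the limit of elements of the closed subspace \<open>F\<close>.
\<close>

lemma successive_approximation:
  fixes R F :: "'z::real_normed_vector set"
  assumes R: "banach_space_on R \<nu>" and C: "\<And>r. r \<in> R \<Longrightarrow> norm r \<le> C * \<nu> r"
    and F: "subspace F" "closed F" and "d > 0"
    and approx: "\<And>y \<rho>. norm y \<le> d \<Longrightarrow> \<rho> > 0 \<Longrightarrow> \<exists>r\<in>R. \<nu> r \<le> 1 \<and> (\<exists>u\<in>F. norm (y - r - u) < \<rho>)"
    and y: "norm y \<le> d"
  obtains r where "r \<in> R" "\<nu> r \<le> 2" "y - r \<in> F"
proof -
  note S = banach_space_on_seminorm[OF R]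
  note sub = seminorm_on_subspace[OF S]
  have scaled: "\<exists>r\<in>R. \<nu> r \<le> 1 / 2 ^ k \<and> (\<exists>u\<in>F. norm (y - r - u) \<le> d / 2 ^ Suc k)"
    if "norm y \<le> d / 2 ^ k" for y and k :: nat
  proof -
    have "norm ((2 ^ k) *\<^sub>R y) \<le> d" using that by (simp add: field_simps)
    then obtain r u where ru: "r \<in> R" "\<nu> r \<le> 1" "u \<in> F" "norm ((2 ^ k) *\<^sub>R y - r - u) < d / 2"
      using approx[of "(2 ^ k) *\<^sub>R y" "d / 2"] \<open>d > 0\<close> by auto
    let ?c = "1 / 2 ^ k :: real"
    have "y - ?c *\<^sub>R r - ?c *\<^sub>R u = ?c *\<^sub>R ((2 ^ k) *\<^sub>R y - r - u)"
      by (simp add: scaleR_diff_right)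
    then have "norm (y - ?c *\<^sub>R r - ?c *\<^sub>R u) = ?c * norm ((2 ^ k) *\<^sub>R y - r - u)" by simp
    also have "\<dots> \<le> ?c * (d / 2)" using ru(4) by (intro mult_left_mono) auto
    finally have "norm (y - ?c *\<^sub>R r - ?c *\<^sub>R u) \<le> d / 2 ^ Suc k" by (simp add: field_simps)
    moreover have "\<nu> (?c *\<^sub>R r) \<le> ?c"
      using ru(1,2) seminorm_on_scaleR[OF S ru(1), of ?c] by (simp add: field_simps)
    ultimately show ?thesis
      using subspace_scale[OF sub ru(1)] subspace_scale[OF F(1) ru(3)] by blast
  qed
  \<comment> \<open>\<open>s\<close> is the partial sum and \<open>z\<close> the error that remains modulo \<open>F\<close>\<close>
  define P where "P = (\<lambda>k (s, z). s \<in> R \<and> y - s - z \<in> F \<and> norm z \<le> d / 2 ^ k \<and> (k = 0 \<longrightarrow> s = 0))"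
  define Q where "Q = (\<lambda>k (s, z :: 'z) (s', z' :: 'z). \<nu> (s' - s) \<le> 1 / 2 ^ k)"
  have "\<exists>x. \<forall>k. P k (x k) \<and> Q k (x k) (x (Suc k))"
  proof (rule dependent_nat_choice)
    show "\<exists>x. P 0 x"
      by (rule exI[of _ "(0, y)"]) (use y F(1) sub in \<open>auto simp: P_def subspace_0\<close>)
    fix x k assume "P k x"
    then obtain s z where x: "x = (s, z)" "s \<in> R" "y - s - z \<in> F" "norm z \<le> d / 2 ^ k"
      unfolding P_def by (cases x) auto
    obtain r u where ru: "r \<in> R" "\<nu> r \<le> 1 / 2 ^ k" "u \<in> F" "norm (z - r - u) \<le> d / 2 ^ Suc k"
      using scaled[OF x(4)] by blast
    have "y - (s + r) - (z - r - u) = (y - s - z) + u" by simp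
    then have "y - (s + r) - (z - r - u) \<in> F" using x(3) ru(3) F(1) subspace_add by metis
    then have "P (Suc k) (s + r, z - r - u)"
      using x ru subspace_add[OF sub] by (simp add: P_def)
    moreover have "Q k x (s + r, z - r - u)" using ru(2) x(1) by (simp add: Q_def)
    ultimately show "\<exists>x'. P (Suc k) x' \<and> Q k x x'" by blast
  qed
  then obtain x where x: "\<And>k. P k (x k)" "\<And>k. Q k (x k) (x (Suc k))" by blast
  define s where "s k = fst (x k)" for k
  define z where "z k = snd (x k)" for k
  have s: "s k \<in> R" "y - s k - z k \<in> F" "norm (z k) \<le> d / 2 ^ k" for k
    using x(1)[of k] by (auto simp: P_def s_def z_def split_beta)
  have step: "\<nu> (s (Suc k) - s k) \<le> 1 / 2 ^ k" for k
    using x(2)[of k] by (auto simp: Q_def s_def split_beta)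
  have inR: "s i - s j \<in> R" for i j using s(1) sub by (simp add: subspace_diff)
  have tail: "\<nu> (s (k + j) - s k) \<le> 2 / 2 ^ k - 2 / 2 ^ (k + j)" for k j
  proof (induction j)
    case 0
    then show ?case by (simp add: seminorm_on_zero[OF S])
  next
    case (Suc j)
    have "\<nu> (s (k + Suc j) - s k) \<le> \<nu> (s (Suc (k + j)) - s (k + j)) + \<nu> (s (k + j) - s k)"
      using seminorm_on_add[OF S inR inR, of "Suc (k + j)" "k + j" "k + j" k] by simp
    moreover have "1 / 2 ^ (k + j) = 2 / 2 ^ (k + j) - 2 / (2 :: real) ^ (k + Suc j)"
      by (simp add: field_simps)
    ultimately show ?case using Suc step[of "k + j"] by linarith
  qed
  have tail': "\<nu> (s i - s k) \<le> 2 / 2 ^ k" if "i \<ge> k" for i k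
  proof -
    have "0 \<le> 2 / (2 :: real) ^ i" by simp
    moreover have "\<nu> (s i - s k) \<le> 2 / 2 ^ k - 2 / 2 ^ i"
      using tail[of k "i - k"] that by simp
    ultimately show ?thesis by linarith
  qed
  have lim0: "(\<lambda>k. c / 2 ^ k) \<longlonglongrightarrow> (0::real)" for c
    using tendsto_mult_right_zero[OF LIMSEQ_power_zero[of "1/2::real"], of c]
    by (simp add: power_divide)
  have "\<exists>N. \<forall>i\<ge>N. \<forall>j\<ge>N. \<nu> (s i - s j) < e" if "e > 0" for e
  proof -
    have "eventually (\<lambda>k. 4 / 2 ^ k < e) sequentially"
      using lim0[of 4] that by (rule order_tendstoD(2))
    then obtain N where N: "4 / 2 ^ N < e" by (auto simp: eventually_sequentially)
    have "\<nu> (s i - s j) < e" if "i \<ge> N" "j \<ge> N" for i j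
    proof -
      have "\<nu> (s i - s j) \<le> \<nu> (s i - s N) + \<nu> (s j - s N)"
        using seminorm_on_diff[OF S inR inR, of i N j N] by simp
      then show ?thesis using tail'[OF that(1)] tail'[OF that(2)] N by simp
    qed
    then show ?thesis by blast
  qed
  then obtain r where r: "r \<in> R" "(\<lambda>k. \<nu> (s k - r)) \<longlonglongrightarrow> 0"
    using R s(1) unfolding banach_space_on_def by blast
  have "\<nu> (s k) \<le> 2" for k
    using tail'[of 0 k] x(1)[of 0] by (auto simp: P_def s_def split_beta)
  moreover have "\<nu> r \<le> \<nu> (s k) + \<nu> (s k - r)" for k
    using seminorm_on_diff[OF S s(1) subspace_diff[OF sub s(1) r(1)], of k k] by simp
  ultimately have "\<nu> r \<le> 2 + \<nu> (s k - r)" for k by (meson add_right_mono order_trans)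
  then have "\<nu> r \<le> 2 + 0"
    by (intro LIMSEQ_le_const[OF tendsto_add[OF tendsto_const r(2)]]) auto
  moreover have "y - r \<in> F"
  proof (rule closed_sequentially[OF F(2)])
    show "y - s k - z k \<in> F" for k by (rule s(2))
    have "(\<lambda>k. C * \<nu> (s k - r)) \<longlonglongrightarrow> 0"
      using tendsto_mult_right_zero[OF r(2)] .
    moreover have "norm (s k - r) \<le> C * \<nu> (s k - r)" for k
      using C s(1) r(1) sub by (simp add: subspace_diff)
    ultimately have "(\<lambda>k. s k - r) \<longlonglongrightarrow> 0"
      by (intro Lim_null_comparison[of "\<lambda>k. s k - r" "\<lambda>k. C * \<nu> (s k - r)"]) auto
    moreover have "z \<longlonglongrightarrow> 0"
      using s(3) lim0[of d] by (intro Lim_null_comparison[of z "\<lambda>k. d / 2 ^ k"]) auto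
    ultimately have "(\<lambda>k. y - r - (s k - r) - z k) \<longlonglongrightarrow> y - r - 0 - 0"
      by (intro tendsto_intros)
    then show "(\<lambda>k. y - s k - z k) \<longlonglongrightarrow> y - r" by simp
  qed
  ultimately show ?thesis using that[of r] r(1) by simp
qed

text \<open>
  Successive approximation writes every \<open>y\<close> with \<open>\<parallel>y\<parallel> \<le> d\<close> as \<open>r + v\<close> with \<open>\<nu> r \<le> 2\<close> and \<open>v\<close> in the
  span \<open>F\<close> of the \<open>f\<^sub>i\<close>.  If \<open>y\<close> is itself in \<open>R\<close>, then \<open>v\<close> lies in \<open>R \<inter> F\<close>.  This
  space is finite-dimensional, so that \<open>\<nu>\<close> is bounded by the norm on it, and both summands of \<open>y\<close>
  are controlled.
\<close>

lemma finite_codim_range_bounded_below: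
  fixes R :: "'z::real_normed_vector set" and g :: "nat \<Rightarrow> 'z \<Rightarrow>\<^sub>L real"
  assumes R: "banach_space_on R \<nu>" and C: "\<And>r. r \<in> R \<Longrightarrow> norm r \<le> C * \<nu> r"
    and bi: "\<forall>i<n. \<forall>j<n. g i (f j) = (if i = j then 1 else 0)" and d: "d > 0"
    and approx: "\<And>y \<rho>. norm y \<le> d \<Longrightarrow> \<rho> > 0
      \<Longrightarrow> \<exists>r\<in>R. \<nu> r \<le> 1 \<and> (\<exists>u\<in>span (f ` {..<n}). norm (y - r - u) < \<rho>)"
  shows "\<exists>K. \<forall>r\<in>R. \<nu> r \<le> K * norm r"
proof -
  note S = banach_space_on_seminorm[OF R]
  note sub = seminorm_on_subspace[OF S]
  let ?F = "span (f ` {..<n})"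
  have "closed {w + u | w u. w \<in> {0} \<and> u \<in> ?F}"
    by (rule closed_sum_biorthogonal_span[OF _ _ _ bi]) (auto simp: blinfun.zero_right)
  then have F: "closed ?F" by simp
  obtain S where S': "linear S" "range S \<subseteq> R \<inter> ?F" "\<And>v. v \<in> R \<inter> ?F \<Longrightarrow> S v = v"
    using linear_exists_left_inverse_on[OF linear_id, of "R \<inter> ?F"] subspace_inter[OF sub subspace_span]
    by auto
  \<comment> \<open>Expanding \<open>v = S v\<close> in the \<open>f\<^sub>i\<close> needs \<open>\<nu>\<close> only at the vectors \<open>S (f i)\<close>, which lie in \<open>R\<close>
    even if the \<open>f i\<close> do not.\<close>
  have SR: "S v \<in> R" for v using S'(2) by blast
  define K where "K = (\<Sum>i<n. norm (g i) * \<nu> (S (f i)))"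
  have small: "\<nu> v \<le> K * norm v" if v: "v \<in> R" "v \<in> ?F" for v
  proof -
    have "v = (\<Sum>i<n. g i v *\<^sub>R f i)"
      using biorthogonal_expansion[of n "\<lambda>i. blinfun_apply (g i)", OF _ bi v(2)]
      by (simp add: blinfun.bounded_linear_right bounded_linear.linear)
    then have "v = S (\<Sum>i<n. g i v *\<^sub>R f i)" using S'(3) v by simp
    also have "\<dots> = (\<Sum>i<n. g i v *\<^sub>R S (f i))"
      by (simp add: linear_sum[OF S'(1)] linear_cmul[OF S'(1)])
    finally have "\<nu> v \<le> (\<Sum>i<n. \<nu> (g i v *\<^sub>R S (f i)))"
      using seminorm_on_sum[OF S, of "{..<n}" "\<lambda>i. g i v *\<^sub>R S (f i)"] SR sub
      by (auto simp: subspace_scale)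
    also have "\<dots> \<le> (\<Sum>i<n. norm (g i) * \<nu> (S (f i)) * norm v)"
    proof (rule sum_mono)
      fix i
      have "\<bar>g i v\<bar> * \<nu> (S (f i)) \<le> (norm (g i) * norm v) * \<nu> (S (f i))"
        using norm_blinfun[of "g i" v] seminorm_on_nonneg[OF S SR] by (intro mult_right_mono) auto
      then show "\<nu> (g i v *\<^sub>R S (f i)) \<le> norm (g i) * \<nu> (S (f i)) * norm v"
        using seminorm_on_scaleR[OF S SR] by (simp add: mult_ac)
    qed
    finally show ?thesis by (simp add: K_def sum_distrib_right)
  qed
  have K: "K \<ge> 0" unfolding K_def by (intro sum_nonneg mult_nonneg_nonneg seminorm_on_nonneg[OF S SR]) auto
  have "\<nu> x \<le> (2 + K * (d + 2 * \<bar>C\<bar>)) / d * norm x" if x: "x \<in> R" for x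
  proof (cases "x = 0")
    case True
    then show ?thesis by (simp add: seminorm_on_zero[OF S])
  next
    case False
    define y where "y = (d / norm x) *\<^sub>R x"
    have y: "y \<in> R" "norm y \<le> d" using x sub False d by (auto simp: y_def subspace_scale)
    obtain r where r: "r \<in> R" "\<nu> r \<le> 2" "y - r \<in> ?F"
      using successive_approximation[OF R C subspace_span F d approx y(2)] by metis
    have "norm r \<le> \<bar>C\<bar> * 2"
      using C[OF r(1)] mult_mono[of C "\<bar>C\<bar>" "\<nu> r" 2] r(2) seminorm_on_nonneg[OF S r(1)] by linarith
    then have "norm (y - r) \<le> d + 2 * \<bar>C\<bar>"
      using norm_triangle_ineq4[of y r] y(2) by linarith
    then have "\<nu> (y - r) \<le> K * (d + 2 * \<bar>C\<bar>)"
      using small[OF subspace_diff[OF sub y(1) r(1)] r(3)] K by (meson mult_left_mono order_trans)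
    then have "\<nu> y \<le> 2 + K * (d + 2 * \<bar>C\<bar>)"
      using seminorm_on_add[OF S r(1) subspace_diff[OF sub y(1) r(1)]] r(2) by simp
    moreover have "\<nu> y = d / norm x * \<nu> x"
      using seminorm_on_scaleR[OF S x, of "d / norm x"] d by (simp add: y_def)
    ultimately show ?thesis using d False by (simp add: field_simps)
  qed
  then show ?thesis by blast
qed

text \<open>
  The map \<open>r \<mapsto> r - \<Sum>\<^sub>n g\<^sub>n(r) f\<^sub>n\<close> is a small nuclear perturbation of the inclusion of \<open>R\<close>, and takes its
  values in the common kernel of the \<open>g\<^sub>n\<close>.
\<close>

theorem operator_range_near_infinite_codimension:
  fixes R :: "'z::banach set"
  assumes R: "banach_space_on R \<nu>" and C: "\<And>r. r \<in> R \<Longrightarrow> norm r \<le> C * \<nu> r"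
    and unbounded: "\<not> (\<exists>K. \<forall>r\<in>R. \<nu> r \<le> K * norm r)" and \<epsilon>: "\<epsilon> > 0"
  obtains W where "subspace W" "closed W" "infinite_codimension W"
    "\<And>r. r \<in> R \<Longrightarrow> \<exists>w\<in>W. norm (r - w) \<le> \<epsilon> * \<nu> r"
proof -
  note S = banach_space_on_seminorm[OF R]
  define e where "e n = \<epsilon> * (1/2) ^ Suc n" for n
  have e_pos: "e n > 0" for n using \<epsilon> by (simp add: e_def)
  have e_sums: "e sums \<epsilon>" unfolding e_def using sums_mult[OF power_half_series, of \<epsilon>] by simp
  obtain f and g :: "nat \<Rightarrow> 'z \<Rightarrow>\<^sub>L real" where bi: "\<And>i j. g i (f j) = (if i = j then 1 else 0)"
    and f: "\<And>n. norm (f n) \<le> e n" and g: "\<And>n r. r \<in> R \<Longrightarrow> \<bar>g n r\<bar> \<le> \<nu> r"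
  proof (rule biorthogonal_sequence[OF S, where e = e])
    show "e n > 0" for n by (rule e_pos)
  next
    fix n f and g :: "nat \<Rightarrow> 'z \<Rightarrow>\<^sub>L real" and d :: real
    assume bi: "\<forall>i<n. \<forall>j<n. g i (f j) = (if i = j then 1 else 0)" and d: "d > 0"
    show "\<exists>y \<rho>. norm y \<le> d \<and> \<rho> > 0
        \<and> (\<forall>r\<in>R. \<nu> r \<le> 1 \<longrightarrow> (\<forall>u\<in>span (f ` {..<n}). \<rho> \<le> norm (y - r - u)))"
    proof (rule ccontr)
      assume neg: "\<not> ?thesis"
      have "\<exists>r\<in>R. \<nu> r \<le> 1 \<and> (\<exists>u\<in>span (f ` {..<n}). norm (y - r - u) < \<rho>)"
        if "norm y \<le> d" "\<rho> > 0" for y \<rho>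
        using neg that by (meson not_le)
      with unbounded show False using finite_codim_range_bounded_below[OF R C bi d] by blast
    qed
  qed blast
  define W where "W = {z. \<forall>n. g n z = 0}"
  show ?thesis
  proof (rule that)
    show "subspace W"
      by (rule subspaceI) (auto simp: W_def blinfun.zero_right blinfun.add_right blinfun.scaleR_right)
    show "closed W"
      unfolding W_def by (intro closed_Collect_all closed_Collect_eq continuous_intros)
    show "infinite_codimension W"
      by (rule infinite_codimension_if_biorthogonal[of "\<lambda>n. blinfun_apply (g n)", OF _ bi])
        (auto simp: W_def blinfun.bounded_linear_right bounded_linear.linear)
    fix r assume r: "r \<in> R"
    have bound: "norm (g n r *\<^sub>R f n) \<le> \<nu> r * e n" for n
      using mult_mono[OF g[OF r] f] seminorm_on_nonneg[OF S r] by simp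
    have sm: "(\<lambda>n. \<nu> r * e n) sums (\<nu> r * \<epsilon>)" by (rule sums_mult[OF e_sums])
    have sf: "summable (\<lambda>n. g n r *\<^sub>R f n)"
      by (rule summable_comparison_test'[OF sums_summable[OF sm]]) (use bound in auto)
    define v where "v = (\<Sum>n. g n r *\<^sub>R f n)"
    have "g k (r - v) = 0" for k
    proof -
      have "g k v = (\<Sum>n. g k (g n r *\<^sub>R f n))"
        unfolding v_def by (rule bounded_linear.suminf[OF blinfun.bounded_linear_right sf])
      also have "\<dots> = (\<Sum>n. if n = k then g n r else 0)"
        by (intro suminf_cong) (simp add: blinfun.scaleR_right bi)
      also have "\<dots> = g k r" by (rule sums_unique[symmetric, OF sums_single])
      finally show ?thesis by (simp add: blinfun.diff_right)
    qed
    then have "r - v \<in> W" by (simp add: W_def)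
    moreover have "norm v \<le> \<epsilon> * \<nu> r"
      using norm_suminf_le[OF bound sums_summable[OF sm]] sums_unique[OF sm]
      by (simp add: v_def mult.commute)
    ultimately show "\<exists>w\<in>W. norm (r - w) \<le> \<epsilon> * \<nu> r" by (intro bexI[of _ "r - v"]) auto
  qed
qed

text \<open>
  \<open>V\<close> is the injective image of the Banach space \<open>W \<times> \<ell>\<^sup>\<infinity>\<close> under \<open>(w, a) \<mapsto> w + \<Sum>\<^sub>n a\<^sub>n f\<^sub>n\<close>, where
  \<open>g\<^sub>n\<close> recovers the coordinate \<open>a\<^sub>n\<close>.  The norms are not equivalent because \<open>f\<^sub>n\<close> comes from a unit
  sequence while \<open>\<parallel>f\<^sub>n\<parallel>\<close> tends to \<open>0\<close>.
\<close>

theorem infinite_codimension_enlargement: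
  fixes W :: "'z::banach set"
  assumes W: "subspace W" "closed W" and codim: "infinite_codimension W"
  obtains V \<nu> C where "banach_space_on V \<nu>" "W \<subseteq> V" "\<And>w. w \<in> W \<Longrightarrow> \<nu> w = norm w"
    "\<And>v. v \<in> V \<Longrightarrow> norm v \<le> C * \<nu> v" "\<not> (\<exists>K. \<forall>v\<in>V. \<nu> v \<le> K * norm v)"
proof -
  define e :: "nat \<Rightarrow> real" where "e n = (1/2) ^ Suc n" for n
  have e_pos: "e n > 0" for n by (simp add: e_def)
  have e_sums: "e sums 1" unfolding e_def using power_half_series .
  have S: "seminorm_on W (\<lambda>_. 0)" using W by (simp add: seminorm_on_def)
  obtain f and g :: "nat \<Rightarrow> 'z \<Rightarrow>\<^sub>L real" where bi: "\<And>i j. g i (f j) = (if i = j then 1 else 0)"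
    and f: "\<And>n. norm (f n) \<le> e n" and gW: "\<And>n w. w \<in> W \<Longrightarrow> \<bar>g n w\<bar> \<le> 0"
  proof (rule biorthogonal_sequence[OF S, where e = e])
    show "e n > 0" for n by (rule e_pos)
  next
    fix n f and g :: "nat \<Rightarrow> 'z \<Rightarrow>\<^sub>L real" and d :: real
    assume bi: "\<forall>i<n. \<forall>j<n. g i (f j) = (if i = j then 1 else 0)"
      and gW: "\<forall>i<n. \<forall>w\<in>W. \<bar>g i w\<bar> \<le> 0" and d: "d > 0"
    \<comment> \<open>\<open>W\<close> plus a finite-dimensional space is closed and proper, so arbitrarily small vectors have
      positive distance from it.\<close>
    let ?A = "{w + u | w u. w \<in> W \<and> u \<in> span (f ` {..<n})}"
    have A: "?A = span (W \<union> f ` {..<n})" unfolding span_Un span_subspace[OF order_refl span_superset W(1)] by auto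
    have "closed ?A" using gW by (intro closed_sum_biorthogonal_span[OF W _ bi]) auto
    obtain y0 where y0: "y0 \<notin> ?A" using codim unfolding A infinite_codimension_def by blast
    define y where "y = (d / norm y0) *\<^sub>R y0"
    have "y0 \<noteq> 0" using y0 span_zero[of "W \<union> f ` {..<n}"] unfolding A by blast
    then have "norm y \<le> d" and y0_eq: "y0 = (norm y0 / d) *\<^sub>R y" using d by (auto simp: y_def)
    have "y \<notin> ?A" using y0 span_scale[of y "W \<union> f ` {..<n}" "norm y0 / d"] y0_eq unfolding A by auto
    then obtain \<rho> where \<rho>: "\<rho> > 0" "ball y \<rho> \<subseteq> - ?A"
      using openE[OF open_Compl[OF \<open>closed ?A\<close>], of y] by blast
    have far: "\<rho> \<le> dist y a" if "a \<in> ?A" for a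
      using \<rho>(2) that by (meson ComplD mem_ball not_le subsetD)
    have "\<rho> \<le> norm (y - w - u)" if "w \<in> W" "u \<in> span (f ` {..<n})" for w u
      using that far[of "w + u"] by (auto simp: dist_norm diff_diff_eq)
    then show "\<exists>y \<rho>. norm y \<le> d \<and> \<rho> > 0
        \<and> (\<forall>r\<in>W. (0::real) \<le> 1 \<longrightarrow> (\<forall>u\<in>span (f ` {..<n}). \<rho> \<le> norm (y - r - u)))"
      using \<rho>(1) \<open>norm y \<le> d\<close> by blast
  qed blast
  have gW: "g n w = 0" if "w \<in> W" for n w using gW[OF that, of n] by simp
  define \<Phi> where "\<Phi> = (\<lambda>(w, a :: nat \<Rightarrow>\<^sub>C real). w + (\<Sum>n. apply_bcontfun a n *\<^sub>R f n))"
  have bound: "norm (apply_bcontfun a n *\<^sub>R f n) \<le> norm a * e n" for a :: "nat \<Rightarrow>\<^sub>C real" and n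
    using mult_mono[OF norm_bounded[of a n] f] by simp
  have sm: "(\<lambda>n. norm a * e n) sums norm a" for a :: "nat \<Rightarrow>\<^sub>C real"
    using sums_mult[OF e_sums, of "norm a"] by simp
  have sf: "summable (\<lambda>n. apply_bcontfun a n *\<^sub>R f n)" for a :: "nat \<Rightarrow>\<^sub>C real"
    by (rule summable_comparison_test'[OF sums_summable[OF sm[of a]]]) (use bound in auto)
  have norm_\<Phi>: "norm (\<Phi> p) \<le> 2 * norm p" for p
  proof -
    obtain w a where p: "p = (w, a)" by (cases p)
    have "norm (\<Sum>n. apply_bcontfun a n *\<^sub>R f n) \<le> norm a"
      using norm_suminf_le[OF bound sums_summable[OF sm], of a] sums_unique[OF sm[of a]] by metis
    then have "norm (\<Phi> p) \<le> norm w + norm a"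
      unfolding p \<Phi>_def by (auto intro: norm_triangle_le)
    then show ?thesis using norm_fst_le[of w a] norm_snd_le[of a w] p by simp
  qed
  have \<Phi>_add: "\<Phi> (p + q) = \<Phi> p + \<Phi> q" for p q
    unfolding \<Phi>_def
    by (auto simp: split_beta scaleR_add_left suminf_add[OF sf sf, symmetric] plus_bcontfun.rep_eq)
  have \<Phi>_scale: "\<Phi> (t *\<^sub>R p) = t *\<^sub>R \<Phi> p" for t p
    unfolding \<Phi>_def
    by (auto simp: split_beta scaleR_add_right suminf_scaleR_right[OF sf] scaleR_bcontfun.rep_eq)
  have coord: "g k (\<Phi> (w, a)) = apply_bcontfun a k" if "w \<in> W" for k w a
  proof -
    have "g k (\<Sum>n. apply_bcontfun a n *\<^sub>R f n) = (\<Sum>n. g k (apply_bcontfun a n *\<^sub>R f n))"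
      by (rule bounded_linear.suminf[OF blinfun.bounded_linear_right sf])
    also have "\<dots> = (\<Sum>n. if n = k then apply_bcontfun a n else 0)"
      by (intro suminf_cong) (simp add: blinfun.scaleR_right bi)
    also have "\<dots> = apply_bcontfun a k" by (rule sums_unique[symmetric, OF sums_single])
    finally show ?thesis using gW[OF that] by (simp add: \<Phi>_def blinfun.add_right)
  qed
  let ?S = "W \<times> (UNIV :: (nat \<Rightarrow>\<^sub>C real) set)"
  have inj: "inj_on \<Phi> ?S"
  proof (rule inj_onI, clarify)
    fix w w' a a' assume w: "w \<in> W" "w' \<in> W" and eq: "\<Phi> (w, a) = \<Phi> (w', a')"
    have "a = a'" using coord[OF w(1), of _ a] coord[OF w(2), of _ a'] eq by (intro bcontfun_eqI) simp
    with eq show "w = w' \<and> a = a'" by (simp add: \<Phi>_def)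
  qed
  let ?\<nu> = "\<lambda>z. norm (inv_into ?S \<Phi> z)"
  have inv: "inv_into ?S \<Phi> (\<Phi> p) = p" if "p \<in> ?S" for p using inj that by simp
  have \<Phi>0: "\<Phi> (w, 0) = w" for w by (simp add: \<Phi>_def zero_bcontfun.rep_eq)
  show ?thesis
  proof (rule that)
    have "subspace ?S" using W(1) by (auto simp: subspace_def zero_prod_def)
    then have "banach_space_on ?S norm"
      using W(2) by (intro banach_space_on_complete_subspace complete_Times complete_UNIV_bcontfun)
        (simp_all add: complete_eq_closed)
    then show "banach_space_on (\<Phi> ` ?S) ?\<nu>"
      by (rule banach_space_on_image[OF _ inj \<Phi>_add \<Phi>_scale])
    show "W \<subseteq> \<Phi> ` ?S"
      by (intro subsetI image_eqI[of _ \<Phi> "(_, 0)"]) (simp_all add: \<Phi>0)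
    show "?\<nu> w = norm w" if "w \<in> W" for w using inv[of "(w, 0)"] that \<Phi>0[of w] by (simp add: norm_Pair)
    show "norm v \<le> 2 * ?\<nu> v" if "v \<in> \<Phi> ` ?S" for v using that norm_\<Phi> inv by auto
    show "\<not> (\<exists>K. \<forall>v\<in>\<Phi> ` ?S. ?\<nu> v \<le> K * norm v)"
    proof
      assume "\<exists>K. \<forall>v\<in>\<Phi> ` ?S. ?\<nu> v \<le> K * norm v"
      then obtain K where K: "\<And>v. v \<in> \<Phi> ` ?S \<Longrightarrow> ?\<nu> v \<le> K * norm v" by blast
      have "1 \<le> \<bar>K\<bar> * e n" for n
      proof -
        have "(\<lambda>i. if i = n then 1 else (0::real)) \<in> bcontfun"
          by (auto simp: bcontfun_def intro!: finite_imp_bounded finite_subset[of _ "{0, 1}"])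
        then obtain a :: "nat \<Rightarrow>\<^sub>C real" where a: "apply_bcontfun a = (\<lambda>i. if i = n then 1 else 0)"
          by (metis bcontfunE)
        have "\<Phi> (0, a) = (\<Sum>i. if i = n then f i else 0)"
          unfolding \<Phi>_def prod.case a by (simp add: if_distrib[of "\<lambda>c. c *\<^sub>R _"] cong: if_cong)
        also have "\<dots> = f n" by (rule sums_unique[symmetric, OF sums_single])
        finally have fn: "\<Phi> (0, a) = f n" .
        have "1 \<le> norm a" using norm_bounded[of a n] by (simp add: a)
        also have "\<dots> \<le> norm (0 :: 'z, a)" by (simp add: norm_Pair)
        also have "\<dots> = ?\<nu> (f n)" using inv[of "(0, a)"] subspace_0[OF W(1)] fn by simp
        also have "\<dots> \<le> K * norm (f n)" 
          using imageI[of "(0, a)" ?S \<Phi>] subspace_0[OF W(1)] unfolding fn by (intro K) simp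
        also have "\<dots> \<le> \<bar>K\<bar> * e n" using f[of n] by (intro mult_mono) auto
        finally show ?thesis .
      qed
      moreover have "(\<lambda>n. \<bar>K\<bar> * e n) \<longlonglongrightarrow> 0"
        using tendsto_mult_right_zero[OF summable_LIMSEQ_zero[OF sums_summable[OF e_sums]]] .
      ultimately have "(1::real) \<le> 0" by (intro LIMSEQ_le_const) auto
      then show False by simp
    qed
  qed
qed

section \<open>Dual norms and linear homeomorphisms\<close>

lemma normed_space_on_subset:
  assumes "normed_space_on V \<nu>" "subspace L" "L \<subseteq> V"
  shows "normed_space_on L \<nu>"
  using assms unfolding normed_space_on_def by (meson subsetD)

lemma dual_spaceD:
  assumes "f \<in> dual_space V \<nu>"
  shows dual_space_add: "x \<in> V \<Longrightarrow> y \<in> V \<Longrightarrow> f (x + y) = f x + f y"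
    and dual_space_scaleR: "x \<in> V \<Longrightarrow> f (r *\<^sub>R x) = r * f x"
    and dual_space_outside: "x \<notin> V \<Longrightarrow> f x = 0"
  using assms by (auto simp: dual_space_def)

lemma dual_norm_bound:
  assumes N: "normed_space_on V \<nu>" and f: "f \<in> dual_space V \<nu>" and x: "x \<in> V"
  shows "\<bar>f x\<bar> \<le> dual_norm V \<nu> f * \<nu> x"
proof -
  note S = normed_space_on_seminorm[OF N]
  obtain K where K: "\<And>x. x \<in> V \<Longrightarrow> \<bar>f x\<bar> \<le> K * \<nu> x" using f unfolding dual_space_def by blast
  have "\<bar>f x\<bar> \<le> \<bar>K\<bar>" if "x \<in> V" "\<nu> x \<le> 1" for x
    using K[OF that(1)] mult_mono[of K "\<bar>K\<bar>" "\<nu> x" 1] seminorm_on_nonneg[OF S that(1)] that(2)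
    by linarith
  then have bdd: "bdd_above ((\<lambda>x. \<bar>f x\<bar>) ` {x\<in>V. \<nu> x \<le> 1})"
    by (intro bdd_aboveI[of _ "\<bar>K\<bar>"]) auto
  show ?thesis
  proof (cases "x = 0")
    case True
    then show ?thesis using K[OF x] seminorm_on_zero[OF S] by simp
  next
    case False
    then have p: "\<nu> x > 0"
      using normed_space_on_eq_zero[OF N x] seminorm_on_nonneg[OF S x] by linarith
    have "x /\<^sub>R \<nu> x \<in> V" "\<nu> (x /\<^sub>R \<nu> x) \<le> 1"
      using x p seminorm_on_scaleR[OF S x] subspace_scale[OF seminorm_on_subspace[OF S] x] by auto
    then have "\<bar>f (x /\<^sub>R \<nu> x)\<bar> \<le> dual_norm V \<nu> f"
      unfolding dual_norm_def by (intro cSUP_upper bdd) auto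
    then show ?thesis using p dual_space_scaleR[OF f x] by (simp add: abs_mult field_simps)
  qed
qed

lemma dual_norm_least:
  assumes N: "normed_space_on V \<nu>" and "0 \<le> K" and K: "\<And>x. x \<in> V \<Longrightarrow> \<bar>f x\<bar> \<le> K * \<nu> x"
  shows "dual_norm V \<nu> f \<le> K"
  unfolding dual_norm_def
proof (rule cSUP_least)
  note S = normed_space_on_seminorm[OF N]
  show "{x \<in> V. \<nu> x \<le> 1} \<noteq> {}"
    using subspace_0[OF seminorm_on_subspace[OF S]] seminorm_on_zero[OF S] by auto
  fix x assume "x \<in> {x \<in> V. \<nu> x \<le> 1}"
  then show "\<bar>f x\<bar> \<le> K" using K[of x] mult_left_mono[of "\<nu> x" 1 K] \<open>0 \<le> K\<close> by auto
qed

lemma dual_norm_attained_up_to: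
  assumes N: "normed_space_on V \<nu>" and "a < dual_norm V \<nu> f"
  obtains x where "x \<in> V" "\<nu> x \<le> 1" "a < \<bar>f x\<bar>"
proof -
  note S = normed_space_on_seminorm[OF N]
  have "0 \<in> {x \<in> V. \<nu> x \<le> 1}"
    using subspace_0[OF seminorm_on_subspace[OF S]] seminorm_on_zero[OF S] by auto
  then have "{x \<in> V. \<nu> x \<le> 1} \<noteq> {}" by blast
  have "\<exists>x. x \<in> V \<and> \<nu> x \<le> 1 \<and> a < \<bar>f x\<bar>"
  proof (rule ccontr)
    assume "\<not> ?thesis"
    then have "\<bar>f x\<bar> \<le> a" if "x \<in> {x \<in> V. \<nu> x \<le> 1}" for x using that by auto
    then have "dual_norm V \<nu> f \<le> a"
      unfolding dual_norm_def by (intro cSUP_least[OF \<open>_ \<noteq> {}\<close>])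
    with assms(2) show False by simp
  qed
  then show ?thesis using that by blast
qed

lemma normed_space_on_dual:
  assumes N: "normed_space_on V \<nu>"
  shows "normed_space_on (dual_space V \<nu>) (dual_norm V \<nu>)"
proof -
  let ?D = "dual_space V \<nu>" and ?\<mu> = "dual_norm V \<nu>"
  note S = normed_space_on_seminorm[OF N]
  note B = dual_norm_bound[OF N]
  have nonneg: "0 \<le> ?\<mu> f" if "f \<in> ?D" for f
  proof (rule ccontr)
    assume neg: "\<not> 0 \<le> ?\<mu> f"
    have "0 \<in> V" by (rule subspace_0[OF seminorm_on_subspace[OF S]])
    then have "\<bar>f 0\<bar> \<le> ?\<mu> f"
      unfolding dual_norm_def
    proof (intro cSUP_upper)
      show "bdd_above ((\<lambda>x. \<bar>f x\<bar>) ` {x \<in> V. \<nu> x \<le> 1})"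
      proof (rule bdd_aboveI[of _ 0])
        fix t assume "t \<in> (\<lambda>x. \<bar>f x\<bar>) ` {x \<in> V. \<nu> x \<le> 1}"
        then obtain x where "x \<in> V" "t = \<bar>f x\<bar>" by blast
        then show "t \<le> 0"
          using B[OF that, of x] neg seminorm_on_nonneg[OF S, of x]
            mult_nonpos_nonneg[of "?\<mu> f" "\<nu> x"] by linarith
      qed
    qed (simp add: seminorm_on_zero[OF S])
    with neg show False by simp
  qed
  have add: "f + g \<in> ?D \<and> ?\<mu> (f + g) \<le> ?\<mu> f + ?\<mu> g" if f: "f \<in> ?D" and g: "g \<in> ?D" for f g
  proof -
    have bound: "\<bar>(f + g) x\<bar> \<le> (?\<mu> f + ?\<mu> g) * \<nu> x" if "x \<in> V" for x
      using B[OF f that] B[OF g that] by (simp add: algebra_simps)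
    have "f + g \<in> ?D"
      using dual_spaceD[OF f] dual_spaceD[OF g] bound unfolding dual_space_def
      by (auto simp: algebra_simps intro!: exI[of _ "?\<mu> f + ?\<mu> g"])
    moreover have "?\<mu> (f + g) \<le> ?\<mu> f + ?\<mu> g"
      by (rule dual_norm_least[OF N _ bound]) (use nonneg[OF f] nonneg[OF g] in simp)
    ultimately show ?thesis ..
  qed
  have scale_le: "t *\<^sub>R f \<in> ?D \<and> ?\<mu> (t *\<^sub>R f) \<le> \<bar>t\<bar> * ?\<mu> f" if f: "f \<in> ?D" for f t
  proof -
    have bound: "\<bar>(t *\<^sub>R f) x\<bar> \<le> (\<bar>t\<bar> * ?\<mu> f) * \<nu> x" if "x \<in> V" for x
      using mult_left_mono[OF B[OF f that], of "\<bar>t\<bar>"] by (simp add: scaleR_fun_def abs_mult mult.assoc)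
    have "t *\<^sub>R f \<in> ?D"
      using dual_spaceD[OF f] bound unfolding dual_space_def
      by (auto simp: scaleR_fun_def algebra_simps intro!: exI[of _ "\<bar>t\<bar> * ?\<mu> f"])
    moreover have "?\<mu> (t *\<^sub>R f) \<le> \<bar>t\<bar> * ?\<mu> f"
      by (rule dual_norm_least[OF N _ bound]) (use nonneg[OF f] in simp)
    ultimately show ?thesis ..
  qed
  have zero_mem: "0 \<in> ?D" by (auto simp: dual_space_def intro: exI[of _ 0])
  have "?\<mu> 0 \<le> 0" by (rule dual_norm_least[OF N]) simp_all
  with nonneg[OF zero_mem] have zero: "?\<mu> 0 = 0" by simp
  have scale: "?\<mu> (t *\<^sub>R f) = \<bar>t\<bar> * ?\<mu> f" if f: "f \<in> ?D" for f t
  proof (cases "t = 0")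
    case False
    have "?\<mu> ((1 / t) *\<^sub>R (t *\<^sub>R f)) \<le> \<bar>1 / t\<bar> * ?\<mu> (t *\<^sub>R f)"
      using scale_le[of "t *\<^sub>R f" "1 / t"] scale_le[OF f] by blast
    then have "\<bar>t\<bar> * ?\<mu> f \<le> ?\<mu> (t *\<^sub>R f)" using False by (simp add: field_simps)
    then show ?thesis using scale_le[OF f, of t] by simp
  qed (simp add: zero)
  have "subspace ?D"
    by (rule subspaceI) (use zero_mem add scale_le in blast)+
  moreover have "f = 0" if f: "f \<in> ?D" "?\<mu> f = 0" for f
  proof
    show "f x = 0 x" for x
      using B[OF f(1), of x] f(2) dual_space_outside[OF f(1), of x] by (cases "x \<in> V") auto
  qed
  ultimately show ?thesis
    unfolding normed_space_on_def using nonneg zero scale add by blast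
qed

lemma topspace_norm_topology [simp]: "topspace (norm_topology L \<mu>) = L"
proof
  show "topspace (norm_topology L \<mu>) \<subseteq> L"
    using openin_topspace[of "norm_topology L \<mu>"] unfolding openin_norm_topology by blast
  show "L \<subseteq> topspace (norm_topology L \<mu>)"
    by (rule openin_subset) (auto simp: openin_norm_topology intro: exI[of _ 1])
qed

text \<open>
  The usual characterization of isomorphisms onto a subspace by two-sided estimates, for a target whose
  norm is not that of its type.
\<close>

lemma linear_homeomorphism_onto_iff:
  fixes T :: "'a::real_normed_vector \<Rightarrow> 'y::real_vector"
  assumes N: "normed_space_on L \<mu>" and T: "linear T"
  shows "linear_homeomorphism_onto T L \<mu> \<longleftrightarrow>
    range T = L \<and> (\<exists>c>0. \<forall>m. c * norm m \<le> \<mu> (T m)) \<and> (\<exists>C. \<forall>m. \<mu> (T m) \<le> C * norm m)"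
proof
  note S = normed_space_on_seminorm[OF N]
  note sub = seminorm_on_subspace[OF S]
  have T0: "T 0 = 0" by (rule linear_0[OF T])
  {
    assume "linear_homeomorphism_onto T L \<mu>"
    then have hom: "homeomorphic_map euclidean (norm_topology L \<mu>) T"
      by (simp add: linear_homeomorphism_onto_def)
    have range: "range T = L" using homeomorphic_imp_surjective_map[OF hom] by simp
    then have TL: "T m \<in> L" for m by blast
    have inj: "inj T" using homeomorphic_imp_injective_map[OF hom] by simp
    have T_scale: "\<mu> (T (t *\<^sub>R m)) = \<bar>t\<bar> * \<mu> (T m)" for t m
      using seminorm_on_scaleR[OF S TL] by (simp add: linear_cmul[OF T])
    have "openin (norm_topology L \<mu>) {y \<in> L. \<mu> y < 1}"
      unfolding openin_norm_topology
    proof (intro conjI ballI)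
      fix x assume x: "x \<in> {y \<in> L. \<mu> y < 1}"
      have "\<mu> y < 1" if "y \<in> L" "\<mu> (y - x) < 1 - \<mu> x" for y
        using seminorm_on_add[OF S, of x "y - x"] x that subspace_diff[OF sub, of y x] by simp
      then show "\<exists>r>0. \<forall>y\<in>L. \<mu> (y - x) < r \<longrightarrow> y \<in> {y \<in> L. \<mu> y < 1}"
        using x by (intro exI[of _ "1 - \<mu> x"]) auto
    qed auto
    then have "open (T -` {y \<in> L. \<mu> y < 1})"
      using homeomorphic_imp_continuous_map[OF hom]
      by (auto simp: continuous_map_def vimage_def)
    moreover have "0 \<in> T -` {y \<in> L. \<mu> y < 1}"
      using T0 subspace_0[OF sub] seminorm_on_zero[OF S] by simp
    ultimately obtain e where e: "e > 0" "ball 0 e \<subseteq> T -` {y \<in> L. \<mu> y < 1}"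
      by (meson open_contains_ball)
    have up: "\<mu> (T m) \<le> (2 / e) * norm m" for m
    proof (cases "m = 0")
      case True
      then show ?thesis by (simp add: T0 seminorm_on_zero[OF S])
    next
      case False
      then have "(e / (2 * norm m)) *\<^sub>R m \<in> ball 0 e" using e(1) by simp
      then have "\<mu> (T ((e / (2 * norm m)) *\<^sub>R m)) < 1" using e(2) by blast
      then show ?thesis using False e(1) by (simp add: T_scale field_simps)
    qed
    have "openin (norm_topology L \<mu>) (T ` ball 0 1)"
      using homeomorphic_imp_open_map[OF hom] by (simp add: open_map_def)
    moreover have "0 \<in> T ` ball 0 1" by (rule image_eqI[of _ T 0]) (simp_all add: T0)
    ultimately obtain r where "r > 0" "\<forall>y\<in>L. \<mu> (y - 0) < r \<longrightarrow> y \<in> T ` ball 0 1"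
      unfolding openin_norm_topology by meson
    then have r: "r > 0" "\<And>y. y \<in> L \<Longrightarrow> \<mu> y < r \<Longrightarrow> y \<in> T ` ball 0 1" by auto
    have low: "(r / 2) * norm m \<le> \<mu> (T m)" for m
    proof (rule ccontr)
      assume neg: "\<not> ?thesis"
      then have "norm m \<noteq> 0" by (auto simp: T0 seminorm_on_zero[OF S])
      then have m: "norm m > 0" by simp
      let ?m = "(2 / norm m) *\<^sub>R m"
      have "\<mu> (T ?m) < r" using neg m by (simp add: T_scale field_simps)
      then have "?m \<in> ball 0 1" using r(2)[OF TL] inj_image_mem_iff[OF inj] by blast
      moreover have "norm ?m = 2" using m by simp
      ultimately show False by (simp del: norm_scaleR)
    qed
    show "range T = L \<and> (\<exists>c>0. \<forall>m. c * norm m \<le> \<mu> (T m)) \<and> (\<exists>C. \<forall>m. \<mu> (T m) \<le> C * norm m)"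
      using range up low r(1) by (metis half_gt_zero)
  }
  assume "range T = L \<and> (\<exists>c>0. \<forall>m. c * norm m \<le> \<mu> (T m)) \<and> (\<exists>C. \<forall>m. \<mu> (T m) \<le> C * norm m)"
  then obtain c C where range: "range T = L" and c: "c > 0" "\<And>m. c * norm m \<le> \<mu> (T m)"
    and C: "\<And>m. \<mu> (T m) \<le> C * norm m" by blast
  have TL: "T m \<in> L" for m using range by blast
  have inj: "inj T"
    unfolding linear_injective_0[OF T]
  proof (intro allI impI)
    fix m assume "T m = 0"
    then have "c * norm m \<le> 0" using c(2)[of m] seminorm_on_zero[OF S] by simp
    then show "m = 0" using c(1) by (simp add: mult_le_0_iff)
  qed
  have "continuous_map euclidean (norm_topology L \<mu>) T"
    unfolding continuous_map_def
  proof (intro conjI allI impI)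
    fix U assume "openin (norm_topology L \<mu>) U"
    then have U: "\<forall>x\<in>U. \<exists>r>0. \<forall>y\<in>L. \<mu> (y - x) < r \<longrightarrow> y \<in> U"
      by (simp add: openin_norm_topology)
    have "open {m. T m \<in> U}"
      unfolding open_dist
    proof
      fix m assume "m \<in> {m. T m \<in> U}"
      then obtain r where r: "r > 0" "\<And>y. y \<in> L \<Longrightarrow> \<mu> (y - T m) < r \<Longrightarrow> y \<in> U" using U by blast
      have "T m' \<in> U" if "dist m' m < r / (\<bar>C\<bar> + 1)" for m'
      proof (rule r(2)[OF TL])
        have "\<mu> (T m' - T m) \<le> C * norm (m' - m)" using C[of "m' - m"] by (simp add: linear_diff[OF T])
        also have "\<dots> \<le> (\<bar>C\<bar> + 1) * norm (m' - m)" by (intro mult_right_mono) auto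
        also have "\<dots> < r" using that by (simp add: dist_norm field_simps)
        finally show "\<mu> (T m' - T m) < r" .
      qed
      then show "\<exists>e>0. \<forall>m'. dist m' m < e \<longrightarrow> m' \<in> {m. T m \<in> U}"
        using r(1) by (intro exI[of _ "r / (\<bar>C\<bar> + 1)"]) auto
    qed
    then show "openin euclidean {x \<in> topspace euclidean. T x \<in> U}" by simp
  qed (use TL in auto)
  moreover have "open_map euclidean (norm_topology L \<mu>) T"
    unfolding open_map_def
  proof (intro allI impI)
    fix U :: "'a set" assume "openin euclidean U"
    then have U: "open U" by simp
    show "openin (norm_topology L \<mu>) (T ` U)"
      unfolding openin_norm_topology
    proof (intro conjI ballI)
      fix x assume "x \<in> T ` U"
      then obtain m where m: "m \<in> U" "x = T m" by blast
      then obtain e where e: "e > 0" "\<And>m'. dist m' m < e \<Longrightarrow> m' \<in> U"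
        using U unfolding open_dist by blast
      have "y \<in> T ` U" if "y \<in> L" "\<mu> (y - x) < c * e" for y
      proof -
        obtain m' where m': "y = T m'" using \<open>y \<in> L\<close> range by blast
        have "c * norm (m' - m) < c * e"
          using c(2)[of "m' - m"] that(2) m(2) m' by (simp add: linear_diff[OF T])
        then have "dist m' m < e" using c(1) by (simp add: dist_norm)
        then show ?thesis using e(2) m' by blast
      qed
      then show "\<exists>r>0. \<forall>y\<in>L. \<mu> (y - x) < r \<longrightarrow> y \<in> T ` U"
        using c(1) e(1) by (intro exI[of _ "c * e"]) auto
    qed (use TL in auto)
  qed
  ultimately show "linear_homeomorphism_onto T L \<mu>"
    unfolding linear_homeomorphism_onto_def
    using T inj range by (auto intro!: bijective_open_imp_homeomorphic_map)
qed

lemma closedin_range_bounded_below: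
  fixes T :: "'a::banach \<Rightarrow> 'y::real_vector"
  assumes N: "normed_space_on D \<mu>" and T: "linear T" and TD: "range T \<subseteq> D"
    and c: "c > 0" "\<And>m. c * norm m \<le> \<mu> (T m)" and C: "\<And>m. \<mu> (T m) \<le> C * norm m"
  shows "closedin (norm_topology D \<mu>) (range T)"
proof -
  note S = normed_space_on_seminorm[OF N]
  note sub = seminorm_on_subspace[OF S]
  have TD: "T m \<in> D" for m using TD by blast
  have "\<exists>r>0. \<forall>y\<in>D. \<mu> (y - f) < r \<longrightarrow> y \<in> D - range T" if f: "f \<in> D - range T" for f
  proof (rule ccontr)
    assume neg: "\<not> ?thesis"
    have "\<exists>m. \<mu> (T m - f) < inverse (real (Suc n))" for n
      using neg by (metis DiffI imageE inverse_positive_iff_positive of_nat_0_less_iff zero_less_Suc)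
    then obtain m where m: "\<And>n. \<mu> (T (m n) - f) < inverse (real (Suc n))" by metis
    have fD: "T x - f \<in> D" for x using TD f sub by (simp add: subspace_diff)
    have diff: "c * norm (m i - m j) \<le> \<mu> (T (m i) - f) + \<mu> (T (m j) - f)" for i j
      using c(2)[of "m i - m j"] seminorm_on_diff[OF S fD fD, of "m i" "m j"]
      by (simp add: linear_diff[OF T])
    have "Cauchy m"
      unfolding Cauchy_def dist_norm
    proof (intro allI impI)
      fix e :: real assume "e > 0"
      then obtain M where M: "inverse (real (Suc M)) < c * e / 2"
        using reals_Archimedean[of "c * e / 2"] c(1) by auto
      have small: "\<mu> (T (m i) - f) < c * e / 2" if "i \<ge> M" for i
      proof -
        have "inverse (real (Suc i)) \<le> inverse (real (Suc M))" using that by simp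
        then show ?thesis using m[of i] M by linarith
      qed
      have "norm (m i - m j) < e" if "i \<ge> M" "j \<ge> M" for i j
      proof -
        have "c * norm (m i - m j) < c * e"
          using diff[of i j] small[OF that(1)] small[OF that(2)] by linarith
        then show ?thesis using c(1) by simp
      qed
      then show "\<exists>M. \<forall>i\<ge>M. \<forall>j\<ge>M. norm (m i - m j) < e" by blast
    qed
    then obtain x where x: "m \<longlonglongrightarrow> x" by (auto simp: Cauchy_convergent_iff convergent_def)
    have "\<mu> (T x - f) \<le> C * norm (x - m n) + inverse (real (Suc n))" for n
      using seminorm_on_add[OF S subspace_diff[OF sub TD TD] fD, of x "m n" "m n"]
        C[of "x - m n"] m[of n] by (simp add: linear_diff[OF T])
    moreover have "(\<lambda>n. C * norm (x - m n) + inverse (real (Suc n))) \<longlonglongrightarrow> C * norm (x - x) + 0"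
      by (intro tendsto_intros x LIMSEQ_inverse_real_of_nat)
    ultimately have "\<mu> (T x - f) \<le> C * norm (x - x) + 0"
      by (intro LIMSEQ_le_const) auto
    then have "\<mu> (T x - f) = 0" using seminorm_on_nonneg[OF S fD, of x] by simp
    then have "f = T x" using normed_space_on_eq_zero[OF N fD] by simp
    with f show False by blast
  qed
  then show ?thesis
    unfolding closedin_def using TD by (auto simp: openin_norm_topology)
qed

section \<open>Norming subspaces and total nonnorming subspaces\<close>

text \<open>
  The supremum over the unit sphere in \<open>[0, \<infinity>]\<close> is replaced here, and in the next lemma, by the
  existence of a single functional.  A norm bound \<open>B\<close> may take the place of norm \<open>1\<close>, as the
  functionals can be normalized at the cost of the constant.
\<close>

lemma normingI:
  fixes W :: "('a::real_normed_vector \<Rightarrow>\<^sub>L real) set"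
  assumes W: "subspace W" and c: "c > 0"
    and ex: "\<And>m. m \<noteq> 0 \<Longrightarrow> \<exists>w\<in>W. norm w \<le> B \<and> c * norm m \<le> \<bar>blinfun_apply w m\<bar>"
  shows "norming W"
  unfolding norming_def norming_sphere_def
proof (intro exI[of _ "c / (\<bar>B\<bar> + 1)"] conjI ballI)
  show "c / (\<bar>B\<bar> + 1) > 0" using c by simp
  fix m :: 'a
  show "ennreal (c / (\<bar>B\<bar> + 1) * norm m) \<le> (SUP f\<in>blinfun_apply ` {g \<in> W. norm g = 1}. ennreal \<bar>f m\<bar>)"
  proof (cases "m = 0")
    case False
    then obtain w where w: "w \<in> W" "norm w \<le> B" "c * norm m \<le> \<bar>blinfun_apply w m\<bar>" using ex by blast
    have "c * norm m > 0" using c False by simp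
    with w(3) have "w \<noteq> 0" by auto
    then have nw: "norm w > 0" by simp
    have "w /\<^sub>R norm w \<in> {g \<in> W. norm g = 1}"
      using w(1) nw W by (simp add: subspace_scale)
    moreover have "c / (\<bar>B\<bar> + 1) * norm m \<le> \<bar>(w /\<^sub>R norm w) m\<bar>"
    proof -
      have "c / (\<bar>B\<bar> + 1) * norm m = (c * norm m) / (\<bar>B\<bar> + 1)" by simp
      also have "\<dots> \<le> \<bar>blinfun_apply w m\<bar> / norm w"
        using w(2,3) nw c by (intro frac_le) auto
      also have "\<dots> = \<bar>(w /\<^sub>R norm w) m\<bar>"
        using nw by (simp add: blinfun.scaleR_left abs_mult divide_inverse_commute)
      finally show ?thesis .
    qed
    ultimately show ?thesis
      by (intro SUP_upper2[of "blinfun_apply (w /\<^sub>R norm w)"] imageI ennreal_leI) auto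
  qed simp
qed

lemma normingE:
  fixes W :: "('a::real_normed_vector \<Rightarrow>\<^sub>L real) set"
  assumes "norming W"
  obtains c where "c > 0" "\<And>m. m \<noteq> 0 \<Longrightarrow> \<exists>w\<in>W. norm w = 1 \<and> c * norm m \<le> \<bar>blinfun_apply w m\<bar>"
proof -
  obtain c where c: "c > 0"
    and sup: "\<And>m. ennreal (c * norm m) \<le> (SUP f\<in>blinfun_apply ` {g \<in> W. norm g = 1}. ennreal \<bar>f m\<bar>)"
    using assms unfolding norming_def norming_sphere_def by blast
  have "\<exists>w\<in>W. norm w = 1 \<and> (c / 2) * norm m \<le> \<bar>blinfun_apply w m\<bar>" if "m \<noteq> 0" for m
  proof -
    have "ennreal (c / 2 * norm m) < ennreal (c * norm m)"
      using c that by (intro ennreal_lessI) auto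
    also note sup[of m]
    finally obtain w where "w \<in> W" "norm w = 1" "ennreal (c / 2 * norm m) < ennreal \<bar>blinfun_apply w m\<bar>"
      by (auto simp: less_SUP_iff)
    then show ?thesis using ennreal_less_iff[of "c / 2 * norm m" "\<bar>blinfun_apply w m\<bar>"] c by (intro bexI[of _ w]) auto
  qed
  then show ?thesis using that[of "c / 2"] c by simp
qed

text \<open>
  With \<open>c \<parallel>m\<parallel> \<le> \<parallel>T m\<parallel>\<close>, the functionals \<open>J x\<close> for \<open>\<nu> x \<le> 1\<close> reach \<open>c/2 \<parallel>m\<parallel>\<close> at \<open>m\<close>; moving them by at
  most \<open>c/4\<close> into \<open>W\<close> leaves \<open>c/4 \<parallel>m\<parallel>\<close>.
\<close>

theorem norming_subspace_of_total_nonnorming: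
  fixes V :: "'x::real_vector set"
  assumes V: "banach_space_on V \<nu>" and iso: "isomorphic_to_total_nonnorming TYPE('a::real_normed_vector) V \<nu>"
  obtains W :: "('a::real_normed_vector \<Rightarrow>\<^sub>L real) set"
  where "subspace W" "closed W" "norming W" "infinite_codimension W"
proof -
  let ?\<mu> = "dual_norm V \<nu>"
  have N: "normed_space_on V \<nu>" using V by (simp add: banach_space_on_def)
  note S = normed_space_on_seminorm[OF N]
  note sub = seminorm_on_subspace[OF S]
  obtain L and T :: "'a \<Rightarrow> 'x \<Rightarrow> real" where L: "closed_dual_subspace V \<nu> L" "total_on V L"
      "\<not> norming_on V \<nu> L" and hom: "linear_homeomorphism_onto T L ?\<mu>"
    using iso unfolding isomorphic_to_total_nonnorming_def by blast
  have sL: "subspace L" and LD: "L \<subseteq> dual_space V \<nu>"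
    using L(1) closedin_subset unfolding closed_dual_subspace_def by fastforce+
  have NL: "normed_space_on L ?\<mu>"
    by (rule normed_space_on_subset[OF normed_space_on_dual[OF N] sL LD])
  note SL = normed_space_on_seminorm[OF NL]
  have T: "linear T" using hom by (simp add: linear_homeomorphism_onto_def)
  obtain c C where range: "range T = L" and c: "c > 0" "\<And>m. c * norm m \<le> ?\<mu> (T m)"
    and C: "\<And>m. ?\<mu> (T m) \<le> C * norm m"
    using hom unfolding linear_homeomorphism_onto_iff[OF NL T] by blast
  have TL: "T m \<in> L" for m using range by blast
  then have TD: "T m \<in> dual_space V \<nu>" for m using LD by blast
  have T_add: "T (m + m') x = T m x + T m' x" for m m' x by (simp add: linear_add[OF T])
  have T_scale: "T (t *\<^sub>R m) x = t * T m x" for t m x by (simp add: linear_cmul[OF T] scaleR_fun_def)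
  have T_bound: "\<bar>T m x\<bar> \<le> C * \<nu> x * norm m" if x: "x \<in> V" for m x
    using dual_norm_bound[OF N TD x] mult_right_mono[OF C seminorm_on_nonneg[OF S x]]
    by (smt (verit) mult.commute mult.left_commute)
  define J where "J x = Blinfun (\<lambda>m. T m x)" for x
  have J: "J x m = T m x" if x: "x \<in> V" for x m
  proof -
    have "bounded_linear (\<lambda>m. T m x)"
      using T_add T_scale T_bound[OF x]
      by (intro bounded_linear_intro[of _ "C * \<nu> x"]) (auto simp: mult.commute)
    then show ?thesis by (simp add: J_def bounded_linear_Blinfun_apply)
  qed
  have J_add: "J (x + y) = J x + J y" if "x \<in> V" "y \<in> V" for x y
    using that dual_space_add[OF TD that] subspace_add[OF sub that]
    by (intro blinfun_eqI) (simp add: J blinfun.add_left)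
  have J_scale: "J (t *\<^sub>R x) = t *\<^sub>R J x" if "x \<in> V" for t x
    using that dual_space_scaleR[OF TD that] subspace_scale[OF sub that]
    by (intro blinfun_eqI) (simp add: J blinfun.scaleR_left)
  have J_norm: "norm (J x) \<le> \<bar>C\<bar> * \<nu> x" if x: "x \<in> V" for x
  proof (rule norm_blinfun_bound)
    show "0 \<le> \<bar>C\<bar> * \<nu> x" using seminorm_on_nonneg[OF S x] by simp
    have "C * \<nu> x * norm m \<le> \<bar>C\<bar> * \<nu> x * norm m" for m :: 'a
      using seminorm_on_nonneg[OF S x] by (intro mult_right_mono) auto
    then show "norm (J x m) \<le> \<bar>C\<bar> * \<nu> x * norm m" for m
      using T_bound[OF x, of m] J[OF x, of m] by (smt (verit) real_norm_def)
  qed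
  have J_nonzero: "J x \<noteq> 0" if x: "x \<in> V" "x \<noteq> 0" for x
  proof -
    obtain f where "f \<in> L" "f x \<noteq> 0" using L(2) x unfolding total_on_def by blast
    then obtain m where "T m x \<noteq> 0" using range by blast
    then show ?thesis using J[OF x(1), of m] by auto
  qed
  have inj: "inj_on J V"
  proof (rule inj_onI, rule ccontr)
    fix x y assume xy: "x \<in> V" "y \<in> V" "J x = J y" "x \<noteq> y"
    have "J (x - y) = 0"
      using J_add[OF subspace_diff[OF sub xy(1,2)] xy(2)] xy(3) by simp
    then show False using J_nonzero[OF subspace_diff[OF sub xy(1,2)]] xy(4) by simp
  qed
  let ?R = "J ` V" and ?\<nu> = "\<lambda>z. \<nu> (inv_into V J z)"
  have R: "banach_space_on ?R ?\<nu>"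
    by (rule banach_space_on_image[OF V inj J_add J_scale])
  have \<nu>J: "?\<nu> (J x) = \<nu> x" if "x \<in> V" for x using inj that by simp
  \<comment> \<open>If \<open>J\<close> were bounded below, then choosing \<open>m\<close> with \<open>\<bar>J x m\<bar> > \<parallel>J x\<parallel> \<parallel>m\<parallel> / 2\<close> and normalizing
    \<open>T m\<close> would show that \<open>L\<close> is norming.\<close>
  have unbounded: "\<not> (\<exists>K. \<forall>r\<in>?R. ?\<nu> r \<le> K * norm r)"
  proof
    assume "\<exists>K. \<forall>r\<in>?R. ?\<nu> r \<le> K * norm r"
    then obtain K where K: "\<And>x. x \<in> V \<Longrightarrow> \<nu> x \<le> K * norm (J x)" using \<nu>J by auto
    define k where "k = 1 / (2 * (\<bar>K\<bar> + 1) * (\<bar>C\<bar> + 1))"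
    have "ennreal (k * \<nu> x) \<le> (SUP f\<in>{f \<in> L. ?\<mu> f = 1}. ennreal \<bar>f x\<bar>)" if x: "x \<in> V" for x
    proof (cases "x = 0")
      case True
      then show ?thesis by (simp add: seminorm_on_zero[OF S])
    next
      case False
      have "\<exists>m. norm (J x) / 2 * norm m < \<bar>J x m\<bar>"
      proof (rule ccontr)
        assume "\<not> ?thesis"
        then have "norm (J x) \<le> norm (J x) / 2"
          by (intro norm_blinfun_bound) (auto simp: not_less)
        then show False using J_nonzero[OF x False] by simp
      qed
      then obtain m where m: "norm (J x) / 2 * norm m < \<bar>T m x\<bar>" using J[OF x] by auto
      have "T 0 x = 0" using T_scale[of 0 0 x] by simp
      then have "m \<noteq> 0" using m by auto
      then have "0 < c * norm m" using c(1) by simp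
      then have p: "?\<mu> (T m) > 0" using c(2)[of m] by linarith
      have "\<nu> x \<le> (\<bar>K\<bar> + 1) * norm (J x)"
        by (rule order_trans[OF K[OF x]], intro mult_right_mono) auto
      then have "\<nu> x / (2 * (\<bar>K\<bar> + 1)) \<le> norm (J x) / 2" by (simp add: field_simps)
      then have "\<nu> x / (2 * (\<bar>K\<bar> + 1)) * norm m \<le> \<bar>T m x\<bar>"
        using m mult_right_mono[of "\<nu> x / (2 * (\<bar>K\<bar> + 1))" "norm (J x) / 2" "norm m", OF _ norm_ge_zero]
        by linarith
      moreover have "?\<mu> (T m) \<le> (\<bar>C\<bar> + 1) * norm m"
        by (rule order_trans[OF C], intro mult_right_mono) auto
      moreover have "0 \<le> \<nu> x / (2 * (\<bar>K\<bar> + 1))" using seminorm_on_nonneg[OF S x] by simp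
      ultimately have "\<nu> x / (2 * (\<bar>K\<bar> + 1)) * norm m / ((\<bar>C\<bar> + 1) * norm m) \<le> \<bar>T m x\<bar> / ?\<mu> (T m)"
        using p by (intro frac_le) auto
      then have "k * \<nu> x \<le> \<bar>T m x\<bar> / ?\<mu> (T m)"
        using \<open>m \<noteq> 0\<close> by (simp add: k_def mult_ac)
      also have "\<dots> = \<bar>T (m /\<^sub>R ?\<mu> (T m)) x\<bar>"
        using p by (simp add: T_scale abs_mult divide_inverse_commute)
      finally have "ennreal (k * \<nu> x) \<le> ennreal \<bar>T (m /\<^sub>R ?\<mu> (T m)) x\<bar>" by (rule ennreal_leI)
      moreover have "T (m /\<^sub>R ?\<mu> (T m)) \<in> {f \<in> L. ?\<mu> f = 1}"
        using p TL seminorm_on_scaleR[OF SL TL] subspace_scale[OF sL TL]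
        by (simp add: linear_cmul[OF T])
      ultimately show ?thesis by (rule SUP_upper2[rotated])
    qed
    moreover have "k > 0" by (simp add: k_def add_nonneg_pos)
    ultimately have "norming_on V \<nu> L" unfolding norming_on_def norming_sphere_def by blast
    with L(3) show False ..
  qed
  have "c / 4 > 0" using c(1) by simp
  have "norm r \<le> \<bar>C\<bar> * ?\<nu> r" if "r \<in> ?R" for r using that J_norm \<nu>J by auto
  from operator_range_near_infinite_codimension[OF R this unbounded \<open>c / 4 > 0\<close>]
  obtain W where W: "subspace W" "closed W" "infinite_codimension W"
    and near: "\<And>r. r \<in> ?R \<Longrightarrow> \<exists>w\<in>W. norm (r - w) \<le> c / 4 * ?\<nu> r"
    by blast
  have "norming W"
  proof (rule normingI[OF W(1) \<open>c / 4 > 0\<close>])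
    fix m :: 'a assume "m \<noteq> 0"
    then have "0 < c * norm m" using c(1) by simp
    then have "c / 2 * norm m < ?\<mu> (T m)" using c(2)[of m] by linarith
    then obtain x where x: "x \<in> V" "\<nu> x \<le> 1" "c / 2 * norm m < \<bar>T m x\<bar>"
      by (rule dual_norm_attained_up_to[OF N])
    obtain w where w: "w \<in> W" "norm (J x - w) \<le> c / 4 * \<nu> x" using near[of "J x"] x(1) \<nu>J by auto
    have "c / 4 * \<nu> x \<le> c / 4" using x(2) c(1) by simp
    with w(2) have w2: "norm (J x - w) \<le> c / 4" by linarith
    have "\<bar>C\<bar> * \<nu> x \<le> \<bar>C\<bar>" using mult_left_mono[OF x(2), of "\<bar>C\<bar>"] by simp
    then have "norm w \<le> \<bar>C\<bar> + c / 4"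
      using J_norm[OF x(1)] w2 norm_triangle_ineq3[of "J x" w] by linarith
    moreover have "\<bar>J x m - w m\<bar> \<le> c / 4 * norm m"
      using norm_blinfun[of "J x - w" m] mult_right_mono[OF w2, of "norm m"]
      by (simp add: blinfun.diff_left)
    then have "c / 4 * norm m \<le> \<bar>blinfun_apply w m\<bar>"
      using x(3) J[OF x(1), of m] by (simp add: abs_real_def split: if_splits)
    ultimately show "\<exists>w\<in>W. norm w \<le> \<bar>C\<bar> + c / 4 \<and> c / 4 * norm m \<le> \<bar>blinfun_apply w m\<bar>" using w(1) by blast
  qed
  with W that show ?thesis by blast
qed

text \<open>
  If the image of \<open>M\<close> were norming, then \<open>\<nu> v\<close> would be bounded by a multiple of the supremum of
  \<open>\<bar>v m\<bar>\<close> over a bounded set of \<open>m\<close>, hence by a multiple of \<open>\<parallel>v\<parallel>\<close>, which \<open>V\<close> excludes.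
\<close>

theorem total_nonnorming_of_norming_subspace:
  fixes W :: "('a::banach \<Rightarrow>\<^sub>L real) set"
  assumes W: "subspace W" "closed W" "norming W" "infinite_codimension W"
  obtains V :: "('a::banach \<Rightarrow>\<^sub>L real) set" and \<nu>
  where "banach_space_on V \<nu>" "isomorphic_to_total_nonnorming TYPE('a) V \<nu>"
proof -
  obtain V \<nu> C where V: "banach_space_on V \<nu>" and WV: "W \<subseteq> V"
    and \<nu>W: "\<And>w. w \<in> W \<Longrightarrow> \<nu> w = norm w" and C: "\<And>v. v \<in> V \<Longrightarrow> norm v \<le> C * \<nu> v"
    and unbounded: "\<not> (\<exists>K. \<forall>v\<in>V. \<nu> v \<le> K * norm v)"
    using infinite_codimension_enlargement[OF W(1,2,4)] by metis
  obtain c where c: "c > 0" and ex: "\<And>m. m \<noteq> 0 \<Longrightarrow> \<exists>w\<in>W. norm w = 1 \<and> c * norm m \<le> \<bar>blinfun_apply w m\<bar>"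
    using normingE[OF W(3)] by blast
  let ?\<mu> = "dual_norm V \<nu>" and ?D = "dual_space V \<nu>"
  have N: "normed_space_on V \<nu>" using V by (simp add: banach_space_on_def)
  note S = normed_space_on_seminorm[OF N]
  note sub = seminorm_on_subspace[OF S]
  note ND = normed_space_on_dual[OF N]
  define T :: "'a \<Rightarrow> ('a \<Rightarrow>\<^sub>L real) \<Rightarrow> real" where "T m = (\<lambda>v. if v \<in> V then v m else 0)" for m
  have T: "linear T"
    by (rule linearI) (auto simp: T_def scaleR_fun_def blinfun.add_right blinfun.scaleR_right)
  have T_bound: "\<bar>T m v\<bar> \<le> \<bar>C\<bar> * norm m * \<nu> v" if v: "v \<in> V" for m v
  proof -
    have "\<bar>v m\<bar> \<le> norm v * norm m" using norm_blinfun[of v m] by simp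
    also have "\<dots> \<le> (\<bar>C\<bar> * \<nu> v) * norm m"
      by (intro mult_right_mono order_trans[OF C[OF v]] seminorm_on_nonneg[OF S v]) auto
    finally show ?thesis using v by (simp add: T_def mult_ac)
  qed
  have TD: "T m \<in> ?D" for m
    unfolding dual_space_def
    using sub T_bound[of _ m]
    by (auto simp: T_def subspace_add subspace_scale blinfun.add_left blinfun.scaleR_left)
  have up: "?\<mu> (T m) \<le> \<bar>C\<bar> * norm m" for m
    by (rule dual_norm_least[OF N _ T_bound]) auto
  have low: "c * norm m \<le> ?\<mu> (T m)" for m
  proof (cases "m = 0")
    case True
    then show ?thesis using linear_0[OF T] seminorm_on_zero[OF normed_space_on_seminorm[OF ND]] by simp
  next
    case False
    then obtain w where w: "w \<in> W" "norm w = 1" "c * norm m \<le> \<bar>blinfun_apply w m\<bar>" using ex by blast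
    have "w \<in> V" using w(1) WV by blast
    then show ?thesis using dual_norm_bound[OF N TD, of w m] w \<nu>W[OF w(1)] by (simp add: T_def)
  qed
  let ?L = "range T"
  have sL: "subspace ?L" using linear_subspace_image[OF T subspace_UNIV] .
  have LD: "?L \<subseteq> ?D" using TD by blast
  have "closed_dual_subspace V \<nu> ?L"
    unfolding closed_dual_subspace_def
    by (intro conjI sL closedin_range_bounded_below[OF ND T LD c, of "\<bar>C\<bar>"] low up)
  moreover have "total_on V ?L"
    unfolding total_on_def
  proof (intro ballI impI)
    fix v assume v: "v \<in> V" "v \<noteq> 0"
    then obtain m where "v m \<noteq> 0" by (metis blinfun_eqI zero_blinfun.rep_eq)
    then show "\<exists>f\<in>?L. f v \<noteq> 0" using v(1) by (intro bexI[of _ "T m"]) (auto simp: T_def)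
  qed
  moreover have "\<not> norming_on V \<nu> ?L"
  proof
    assume "norming_on V \<nu> ?L"
    then obtain k where k: "k > 0"
      and sup: "\<And>v. v \<in> V \<Longrightarrow> ennreal (k * \<nu> v) \<le> (SUP f\<in>{f \<in> ?L. ?\<mu> f = 1}. ennreal \<bar>f v\<bar>)"
      unfolding norming_on_def norming_sphere_def by blast
    have "\<nu> v \<le> 1 / (c * k) * norm v" if v: "v \<in> V" for v
    proof -
      have "(SUP f\<in>{f \<in> ?L. ?\<mu> f = 1}. ennreal \<bar>f v\<bar>) \<le> ennreal (norm v / c)"
      proof (rule SUP_least)
        fix f assume "f \<in> {f \<in> ?L. ?\<mu> f = 1}"
        then obtain m where m: "f = T m" "?\<mu> (T m) = 1" by auto
        have "norm m \<le> 1 / c" using low[of m] m(2) c by (simp add: field_simps)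
        then have "\<bar>v m\<bar> \<le> norm v * (1 / c)"
          using norm_blinfun[of v m] mult_left_mono[of "norm m" "1 / c" "norm v"] by simp
        then show "ennreal \<bar>f v\<bar> \<le> ennreal (norm v / c)"
          using m(1) v by (intro ennreal_leI) (simp add: T_def)
      qed
      with sup[OF v] have "ennreal (k * \<nu> v) \<le> ennreal (norm v / c)" by (rule order_trans)
      then have "k * \<nu> v \<le> norm v / c" using c by (simp add: ennreal_le_iff)
      then show ?thesis using c k by (simp add: field_simps)
    qed
    with unbounded show False by blast
  qed
  moreover have "linear_homeomorphism_onto T ?L ?\<mu>"
    unfolding linear_homeomorphism_onto_iff[OF normed_space_on_subset[OF ND sL LD] T]
    using c low up by blast
  ultimately have "isomorphic_to_total_nonnorming TYPE('a) V \<nu>"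
    unfolding isomorphic_to_total_nonnorming_def by blast
  with V that show ?thesis by blast
qed

(* 'a is M. First conjunct: the equivalence, with X ranging over the Banach spaces whose underlying
   vector space lies in M*. This is no restriction: M is total, so X maps linearly and injectively
   into M* by evaluation. Second conjunct: the forward implication for X in an arbitrary real
   vector space 'x, so that the choice of the ambient type in the first one does not matter. *)
theorem theorem3p1:
  shows "((\<exists>(V :: ('a::banach \<Rightarrow>\<^sub>L real) set) \<nu>. banach_space_on V \<nu>
             \<and> isomorphic_to_total_nonnorming TYPE('a) V \<nu>)
          \<longleftrightarrow> (\<exists>W :: ('a \<Rightarrow>\<^sub>L real) set. subspace W \<and> closed W \<and> norming W \<and> infinite_codimension W))
       \<and> (\<forall>(V :: 'x::real_vector set) \<nu>. banach_space_on V \<nu>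
             \<and> isomorphic_to_total_nonnorming TYPE('a) V \<nu>
          \<longrightarrow> (\<exists>W :: ('a \<Rightarrow>\<^sub>L real) set. subspace W \<and> closed W \<and> norming W \<and> infinite_codimension W))"
  using norming_subspace_of_total_nonnorming total_nonnorming_of_norming_subspace by metis

end
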